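(* Let $\Omega\subset\mathbb{R}^d$ be a non-empty open set with $|\Omega|<\infty$ and $\mathrm{Per}(\Omega)<\infty$. Assume that there is a constant $C>0$ such that for all $\alpha\in(0,1)$, all $0<\lambda\le1$ and all $0<r<1$, $$h(\lambda r)\le C\alpha^{-1}\lambda^{-\alpha}h(r).$$ Then there exists $t_0>0$ such that for all $t\in(0,t_0)$, $$H(t)=t\,\mathrm{Per}_\nu(\Omega)-\sum_{k=2}^{\infty}\frac{t^k}{k!}\mathcal{L}^kg_\Omega(0).$$
   Context: Let $d\in\mathbb{N}$, $d\geq 1$. Let $\nu$ be a Borel measure on $\mathbb{R}^d$ with $\nu(\{0\})=0$ and $\int_{\mathbb{R}^d}(1\wedge|z|)\,\nu(dz)<\infty$. Put $\psi(\xi)=\int_{\mathbb{R}^d}(1-e^{i\langle\xi,z\rangle})\,\nu(dz)$, and let $(p_t)_{t\ge0}$ be the convolution semigroup of probability measures on $\mathbb{R}^d$ with $\int_{\mathbb{R}^d}e^{i\langle\xi,x\rangle}p_t(dx)=e^{-t\psi(\xi)}$. The concentration function is $h(r)=\int_{\mathbb{R}^d}\left(1\wedge\frac{|x|^2}{r^2}\right)\nu(dx)$, $r>0$. $\mathcal{C}_0(\mathbb{R}^d)$ is the space of continuous functions $f:\mathbb{R}^d\to\mathbb{R}$ vanishing at infinity, with the supremum norm. $P_tf(x)=\int f(x+y)\,p_t(dy)$ defines a semigroup on $\mathcal{C}_0(\mathbb{R}^d)$ and $\mathcal{L}$ is its infinitesimal generator, $\mathcal{L}f=\lim_{t\to0^+}(P_tf-f)/t$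 (limit in the supremum norm). $\mathcal{L}^k$ is the $k$-fold iterate. If $\int_{|y|<1}|y|^\beta\nu(dy)<\infty$ for some $\beta\in(0,1]$ and $f\in\mathcal{C}_0(\mathbb{R}^d)$ satisfies $\sup_{0<|x-y|\le1}|f(x)-f(y)|/|x-y|^\beta<\infty$, then $\mathcal{L}f(x)=\int(f(x+y)-f(x))\,\nu(dy)$. $|\cdot|$ of a set is Lebesgue measure. $g_\Omega(y)=|\Omega\cap(\Omega+y)|$ is the covariance function of $\Omega$, and $\mathcal{L}^kg_\Omega(0)$ means $(\mathcal{L}^kg_\Omega)(0)$. $H(t)=\int_\Omega\int_{\Omega^c-x}p_t(dy)\,dx$ (so the heat content $H_\Omega(t)=\int_\Omega\int_{\Omega-x}p_t(dy)\,dx$ equals $|\Omega|-H(t)$). $\mathrm{Per}_\nu(\Omega)=\int_\Omega\int_{\Omega^c-x}\nu(dy)\,dx$ is the nonlocal perimeter. The classical perimeter is $\mathrm{Per}(\Omega)=\sup\{\int_{\Omega}\mathrm{div}\,\phi(x)\,dx:\phi\in C_c^1(\mathbb{R}^d,\mathbb{R}^d),\ \|\phi\|_\infty\le1\}$. *)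

theory Defs
  imports "HOL-Probability.Probability"
begin

definition levy_exponent :: "(real^'d) measure \<Rightarrow> real^'d \<Rightarrow> complex" where
  "levy_exponent \<nu> \<xi> = (LINT z|\<nu>. 1 - iexp (\<xi> \<bullet> z))"

definition conc_fun :: "(real^'d) measure \<Rightarrow> real \<Rightarrow> real" where
  "conc_fun \<nu> r = (LINT x|\<nu>. min 1 ((norm x)\<^sup>2 / r\<^sup>2))"

text \<open>A family indexed by all reals, of which only the members with nonnegative index matter;
  the last condition is weak convergence to the unit mass at the origin.\<close>

definition convolution_semigroup :: "(real \<Rightarrow> (real^'d) measure) \<Rightarrow> bool" where
  "convolution_semigroup p \<longleftrightarrow>
     (\<forall>t\<ge>0. prob_space (p t) \<and> sets (p t) = sets borel) \<and>
     p 0 = return borel 0 \<and>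
     (\<forall>s\<ge>0. \<forall>t\<ge>0. p (s + t) = (p s \<star> p t)) \<and>
     (\<forall>f :: real^'d \<Rightarrow> real. continuous_on UNIV f \<and> bounded (range f) \<longrightarrow>
        ((\<lambda>t. LINT x|p t. f x) \<longlongrightarrow> f 0) (at_right 0))"

definition C0 :: "(real^'d \<Rightarrow> real) set" where
  "C0 = {f. continuous_on UNIV f \<and> (f \<longlongrightarrow> 0) at_infinity}"

definition semigroup_op ::
    "(real \<Rightarrow> (real^'d) measure) \<Rightarrow> real \<Rightarrow> (real^'d \<Rightarrow> real) \<Rightarrow> real^'d \<Rightarrow> real" where
  "semigroup_op p t f x = (LINT y|p t. f (x + y))"

definition is_generator_value ::
    "(real \<Rightarrow> (real^'d) measure) \<Rightarrow> (real^'d \<Rightarrow> real) \<Rightarrow> (real^'d \<Rightarrow> real) \<Rightarrow> bool" where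
  "is_generator_value p f g \<longleftrightarrow> f \<in> C0 \<and> g \<in> C0 \<and>
     uniform_limit UNIV (\<lambda>t x. (semigroup_op p t f x - f x) / t) g (at_right 0)"

definition generator_domain :: "(real \<Rightarrow> (real^'d) measure) \<Rightarrow> (real^'d \<Rightarrow> real) set" where
  "generator_domain p = {f. \<exists>g. is_generator_value p f g}"

text \<open>Unspecified for functions outside \<^const>\<open>generator_domain\<close>.\<close>

definition generator ::
    "(real \<Rightarrow> (real^'d) measure) \<Rightarrow> (real^'d \<Rightarrow> real) \<Rightarrow> (real^'d \<Rightarrow> real)" where
  "generator p f = (THE g. is_generator_value p f g)"

lemma generator_eqI:
  assumes "is_generator_value p f g"
  shows "generator p f = g"
  unfolding generator_def
proof (rule the_equality[where P = "is_generator_value p f", OF assms])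
  fix h assume "is_generator_value p f h"
  then show "h = g"
    using assms unfolding is_generator_value_def
    by (intro ext) (meson UNIV_I tendsto_uniform_limitI tendsto_unique trivial_limit_at_right_real)
qed

definition covariance_fun :: "(real^'d) set \<Rightarrow> real^'d \<Rightarrow> real" where
  "covariance_fun \<Omega> y = measure lborel (\<Omega> \<inter> (\<lambda>x. x + y) ` \<Omega>)"

definition heat_loss :: "(real \<Rightarrow> (real^'d) measure) \<Rightarrow> (real^'d) set \<Rightarrow> real \<Rightarrow> real" where
  "heat_loss p \<Omega> t = (LINT x:\<Omega>|lborel. measure (p t) ((\<lambda>z. z - x) ` (- \<Omega>)))"

definition nonlocal_perimeter :: "(real^'d) measure \<Rightarrow> (real^'d) set \<Rightarrow> ennreal" where
  "nonlocal_perimeter \<nu> \<Omega> = (\<integral>\<^sup>+x\<in>\<Omega>. emeasure \<nu> ((\<lambda>z. z - x) ` (- \<Omega>)) \<partial>lborel)"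

definition divergence :: "(real^'d \<Rightarrow> real^'d) \<Rightarrow> real^'d \<Rightarrow> real" where
  "divergence \<phi> x = (\<Sum>i\<in>UNIV. frechet_derivative \<phi> (at x) (axis i 1) $ i)"

text \<open>Compactly supported vector fields that are everywhere differentiable with continuous
  directional derivatives; in finite dimension this is continuous differentiability.\<close>

definition C1_compact_support :: "(real^'d \<Rightarrow> real^'d) set" where
  "C1_compact_support = {\<phi>. (\<forall>x. \<phi> differentiable (at x)) \<and>
     (\<forall>v. continuous_on UNIV (\<lambda>x. frechet_derivative \<phi> (at x) v)) \<and>
     compact (closure {x. \<phi> x \<noteq> 0})}"

definition perimeter :: "(real^'d) set \<Rightarrow> ereal" where
  "perimeter \<Omega> = (SUP \<phi>\<in>{\<phi> \<in> C1_compact_support. \<forall>x. norm (\<phi> x) \<le> 1}.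
     ereal (LINT x:\<Omega>|lborel. divergence \<phi> x))"

end

theory Submission
  imports Defs
begin

text \<open>Write \<open>A f x = \<integral> (f (x + y) - f x) \<nu>(dy)\<close> for the jump operator, \<open>P\<close> for the semigroup and
\<open>g\<close> for the covariance function of \<open>\<Omega>\<close>. For a shift \<open>y\<close> the points of \<open>\<Omega>\<close> that leave \<open>\<Omega>\<close> have
measure \<open>g 0 - g y\<close>; by Fubini the heat loss is \<open>g 0 - P t g 0\<close> and the nonlocal perimeter is
\<open>- A g 0\<close> (\<open>heat_loss_eq\<close>, \<open>nonlocal_perimeter_eq\<close>). The claim is therefore that the Taylor series of
\<open>P t g 0\<close> in \<open>t\<close> converges to it for small \<open>t\<close>.

The remainder after \<open>n\<close> terms is at most \<open>t\<^sup>n / n! * sup \<bar>A\<^sup>n g\<bar>\<close>, so everything rests on a bound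
\<open>sup \<bar>A\<^sup>n g\<bar> \<le> K (2 D n)\<^sup>n\<close>, because \<open>n\<^sup>n \<le> n! e\<^sup>n\<close>. It combines three facts. First, \<open>g\<close> is bounded
and, the perimeter being finite, Lipschitz (\<open>covariance_fun_shift_le\<close>). Second, \<open>A\<close> maps Hoelder
functions of exponent \<open>\<beta>\<close> to Hoelder functions of exponent \<open>\<beta> - \<epsilon>\<close>, at the cost of a factor
\<open>2 \<integral> (min 1 \<bar>z\<bar>)\<^sup>\<epsilon> \<nu>(dz)\<close> (\<open>jump_op_holder\<close>). Third, the scaling condition, used with \<open>\<alpha>\<close> of the
order \<open>1 / ln (1 / \<lambda>)\<close>, forces the concentration function to grow at most logarithmically at the
origin, and this makes the moment at most \<open>D / \<epsilon>\<close> (\<open>tnorm_powr_moments_from_scaling\<close>). Starting from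
exponent 1 and spending \<open>\<epsilon> = 1 / n\<close> in each of \<open>n\<close> steps gives the bound (\<open>iterate_bound\<close>).

What links \<open>A\<close> to the semigroup is Dynkin's formula \<open>P t f - f = \<integral>\<^sub>0\<^sup>t P s (A f) ds\<close> for Hoelder \<open>f\<close>
(\<open>dynkin_holder\<close>). The measures \<open>p t\<close> are known only through their Fourier transforms, so the formula
comes from characters, for which it is the differential equation of \<open>exp (- t \<psi>)\<close>; it passes to
superpositions of characters by Fubini, and Gaussian mollifications of damped Hoelder functions
are such superpositions. Applied to \<open>f\<close> and then to \<open>A f\<close>, the formula bounds
\<open>\<bar>(P t f - f) / t - A f\<bar>\<close> by \<open>t sup \<bar>A (A f)\<bar>\<close>, whence \<open>A f\<close> is the generator value of \<open>f\<close>; iterated, it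
gives the Taylor expansion.\<close>

section \<open>Exchanging dominated integrals\<close>

text \<open>Each exchange of integrals of signed or complex kernels below has a dominating function of this
form: a weight in one variable times a weight in the other.\<close>

lemma fubini_swap_dominated:
  fixes F :: "'a \<Rightarrow> 'b \<Rightarrow> 'c::{banach, second_countable_topology}"
  assumes "sigma_finite_measure M" "sigma_finite_measure N"
    and F[measurable]: "(\<lambda>(x, y). F x y) \<in> borel_measurable (M \<Otimes>\<^sub>M N)"
    and a: "integrable M a" and b: "integrable N b"
    and le: "\<And>x y. x \<in> space M \<Longrightarrow> y \<in> space N \<Longrightarrow> norm (F x y) \<le> a x * b y"
  shows "(LINT y|N. LINT x|M. F x y) = (LINT x|M. LINT y|N. F x y)"
    and "\<And>x. x \<in> space M \<Longrightarrow> integrable N (F x)"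
    and "integrable M (\<lambda>x. LINT y|N. F x y)"
proof -
  interpret pair_sigma_finite M N
    using assms(1,2) by (rule pair_sigma_finite.intro)
  note [measurable] = borel_measurable_integrable[OF a] borel_measurable_integrable[OF b]
  show sec: "integrable N (F x)" if "x \<in> space M" for x
    by (rule Bochner_Integration.integrable_bound[OF integrable_mult_right[OF b, of "a x"]])
      (use that le in \<open>force+\<close>)
  have "integrable (M \<Otimes>\<^sub>M N) (\<lambda>(x, y). F x y)"
  proof (rule Fubini_integrable)
    have "integrable M (\<lambda>x. \<bar>a x\<bar> * (LINT y|N. \<bar>b y\<bar>))"
      using a by auto
    then show "integrable M (\<lambda>x. LINT y|N. norm (case (x, y) of (x, y) \<Rightarrow> F x y))"
    proof (rule Bochner_Integration.integrable_bound)
      show "AE x in M. norm (LINT y|N. norm (case (x, y) of (x, y) \<Rightarrow> F x y))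
          \<le> norm (\<bar>a x\<bar> * (LINT y|N. \<bar>b y\<bar>))"
      proof (rule AE_I2)
        fix x assume x: "x \<in> space M"
        have "(LINT y|N. norm (F x y)) \<le> (LINT y|N. \<bar>a x\<bar> * \<bar>b y\<bar>)"
          by (rule integral_mono) (use sec[OF x] b le[OF x] in \<open>auto simp: abs_mult[symmetric] intro: order_trans[OF _ abs_ge_self]\<close>)
        then show "norm (LINT y|N. norm (case (x, y) of (x, y) \<Rightarrow> F x y))
          \<le> norm (\<bar>a x\<bar> * (LINT y|N. \<bar>b y\<bar>))"
          by (simp add: abs_mult)
      qed
    qed measurable
  qed (use sec in auto)
  then show "(LINT y|N. LINT x|M. F x y) = (LINT x|M. LINT y|N. F x y)"
    and "integrable M (\<lambda>x. LINT y|N. F x y)"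
    by (simp_all add: Fubini_integral integrable_fst)
qed

section \<open>Finite perimeter and the covariance function\<close>

lemma open_eq_Union_balls_seq:
  fixes \<Omega> :: "'a::{metric_space, second_countable_topology} set"
  assumes "open \<Omega>" "\<Omega> \<noteq> {}"
  obtains c :: "nat \<Rightarrow> 'a" and r :: "nat \<Rightarrow> real"
  where "\<And>i. 0 < r i" "\<Omega> = (\<Union>i. ball (c i) (r i))"
proof -
  have "\<exists>e>0. ball x e \<subseteq> \<Omega>" if "x \<in> \<Omega>" for x
    using assms(1) that open_contains_ball by blast
  then obtain e where e: "\<And>x. x \<in> \<Omega> \<Longrightarrow> 0 < e x \<and> ball x (e x) \<subseteq> \<Omega>"
    by metis
  obtain \<F> where \<F>: "\<F> \<subseteq> (\<lambda>x. ball x (e x)) ` \<Omega>" "countable \<F>" "\<Union>\<F> = \<Union>((\<lambda>x. ball x (e x)) ` \<Omega>)"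
    using Lindelof[of "(\<lambda>x. ball x (e x)) ` \<Omega>"] by auto
  have un: "\<Union>\<F> = \<Omega>"
    unfolding \<F>(3) using e by fastforce
  then have "\<F> \<noteq> {}"
    using assms(2) by auto
  define B where "B = from_nat_into \<F>"
  have ran: "range B = \<F>"
    unfolding B_def using \<open>\<F> \<noteq> {}\<close> \<F>(2) by (rule range_from_nat_into)
  have "\<exists>x\<in>\<Omega>. B i = ball x (e x)" for i
    using ran \<F>(1) by blast
  then obtain c where c: "\<And>i. c i \<in> \<Omega> \<and> B i = ball (c i) (e (c i))"
    by metis
  have "\<Omega> = (\<Union>i. ball (c i) (e (c i)))"
    using un ran c by (metis (no_types, lifting) SUP_cong)
  then show ?thesis
    using that[of "\<lambda>i. e (c i)" c] e c by blast
qed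

text \<open>The square removes the kink of the positive part, so that bumps built from it are continuously
differentiable.\<close>

lemma has_derivative_pos_part_squared:
  "((\<lambda>u::real. (max 0 u)\<^sup>2) has_field_derivative 2 * max 0 u) (at u)"
proof -
  consider "u > 0" | "u < 0" | "u = 0" by linarith
  then show ?thesis
  proof cases
    case 1
    have "((\<lambda>u::real. u\<^sup>2) has_field_derivative 2 * u) (at u)"
      by (auto intro!: derivative_eq_intros)
    then have "((\<lambda>u::real. (max 0 u)\<^sup>2) has_field_derivative 2 * u) (at u)"
      by (rule has_field_derivative_transform_within_open[where S = "{0<..}"]) (use 1 in auto)
    then show ?thesis using 1 by simp
  next
    case 2
    have "((\<lambda>u::real. 0) has_field_derivative 0) (at u)"
      by (auto intro!: derivative_eq_intros)
    then have "((\<lambda>u::real. (max 0 u)\<^sup>2) has_field_derivative 0) (at u)"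
      by (rule has_field_derivative_transform_within_open[where S = "{..<0}"]) (use 2 in auto)
    then show ?thesis using 2 by simp
  next
    case 3
    have "((\<lambda>h. ((max 0 (0 + h))\<^sup>2 - (max 0 0)\<^sup>2) / h) \<longlongrightarrow> (0::real)) (at 0)"
    proof (rule Lim_null_comparison)
      show "\<forall>\<^sub>F h in at 0. norm (((max 0 (0 + h))\<^sup>2 - (max 0 0)\<^sup>2) / h) \<le> \<bar>h::real\<bar>"
        by (rule always_eventually) (auto simp: max_def power2_eq_square)
      show "((\<lambda>h. \<bar>h::real\<bar>) \<longlongrightarrow> 0) (at 0)"
        by (auto intro!: tendsto_eq_intros)
    qed
    then show ?thesis
      unfolding 3 by (simp add: DERIV_def)
  qed
qed

text \<open>Exhaust \<open>\<Omega>\<close> by balls and let \<open>b i\<close> be a bump that is positive exactly on the \<open>i\<close>-th ball. The function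
\<open>1 - exp (- n * (\<Sum>i<n. b i))\<close> then lies between 0 and 1, lives on finitely many balls, and tends to 1
wherever some bump is positive.\<close>

lemma open_indicator_limit_of_C1_bumps:
  fixes \<Omega> :: "'a::euclidean_space set"
  assumes "open \<Omega>" "\<Omega> \<noteq> {}"
  obtains \<eta> :: "nat \<Rightarrow> 'a \<Rightarrow> real" and \<eta>' :: "nat \<Rightarrow> 'a \<Rightarrow> 'a \<Rightarrow> real"
  where "\<And>n x. 0 \<le> \<eta> n x \<and> \<eta> n x \<le> 1"
    and "\<And>n x. (\<eta> n has_derivative \<eta>' n x) (at x)"
    and "\<And>n v. continuous_on UNIV (\<lambda>x. \<eta>' n x v)"
    and "\<And>n. bounded {x. \<eta> n x \<noteq> 0}"
    and "\<And>x. (\<lambda>n. \<eta> n x) \<longlonglongrightarrow> indicator \<Omega> x"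
proof -
  obtain c :: "nat \<Rightarrow> 'a" and r where r: "\<And>i. 0 < r i" and \<Omega>: "\<Omega> = (\<Union>i. ball (c i) (r i))"
    by (rule open_eq_Union_balls_seq[OF assms]) blast
  define b where "b i x = (max 0 ((r i)\<^sup>2 - (x - c i) \<bullet> (x - c i)))\<^sup>2" for i x
  define b' where "b' i x v = 2 * max 0 ((r i)\<^sup>2 - (x - c i) \<bullet> (x - c i)) * (- 2 * ((x - c i) \<bullet> v))" for i x v
  define \<eta> where "\<eta> n x = 1 - exp (- (real n * (\<Sum>i<n. b i x)))" for n x
  define \<eta>' where "\<eta>' n x v = exp (- (real n * (\<Sum>i<n. b i x))) * (real n * (\<Sum>i<n. b' i x v))" for n x v
  have pos: "b i x > 0 \<longleftrightarrow> x \<in> ball (c i) (r i)" for i x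
  proof -
    have "b i x > 0 \<longleftrightarrow> norm (x - c i) ^ 2 < (r i)\<^sup>2"
      by (auto simp: b_def power2_norm_eq_inner[symmetric] max_def not_less)
    also have "\<dots> \<longleftrightarrow> norm (x - c i) < r i"
      using r[of i] by (meson norm_ge_zero power2_less_imp_less power_strict_mono zero_less_numeral less_imp_le)
    finally show ?thesis
      by (simp add: dist_norm norm_minus_commute)
  qed
  have nn: "0 \<le> b i x" for i x
    by (simp add: b_def)
  have d: "(b i has_derivative b' i x) (at x)" for i x
  proof -
    have "((\<lambda>x. (r i)\<^sup>2 - (x - c i) \<bullet> (x - c i)) has_derivative (\<lambda>v. - 2 * ((x - c i) \<bullet> v))) (at x)"
      by (auto intro!: derivative_eq_intros simp: inner_commute)
    from has_derivative_compose[OF this has_derivative_pos_part_squared[unfolded has_field_derivative_def]]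
    show ?thesis
      unfolding b_def b'_def by simp
  qed
  show thesis
  proof (rule that[of \<eta> \<eta>'])
    show "0 \<le> \<eta> n x \<and> \<eta> n x \<le> 1" for n x
      by (auto simp: \<eta>_def intro!: mult_nonneg_nonneg sum_nonneg nn)
    show "(\<eta> n has_derivative \<eta>' n x) (at x)" for n x
      unfolding \<eta>_def \<eta>'_def
      by (rule derivative_eq_intros d refl | simp add: mult_ac)+
    have contb: "continuous_on UNIV (b i)" for i
      unfolding b_def by (intro continuous_intros)
    have contb': "continuous_on UNIV (\<lambda>x. b' i x v)" for i v
      unfolding b'_def by (intro continuous_intros)
    show "continuous_on UNIV (\<lambda>x. \<eta>' n x v)" for n v
      unfolding \<eta>'_def by (intro continuous_intros contb contb')
    show "bounded {x. \<eta> n x \<noteq> 0}" for n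
    proof (rule bounded_subset)
      show "bounded (\<Union>i<n. ball (c i) (r i))"
        by auto
      show "{x. \<eta> n x \<noteq> 0} \<subseteq> (\<Union>i<n. ball (c i) (r i))"
      proof
        fix x assume "x \<in> {x. \<eta> n x \<noteq> 0}"
        then have "(\<Sum>i<n. b i x) \<noteq> 0"
          by (auto simp: \<eta>_def)
        then obtain i where "i < n" "b i x \<noteq> 0"
          by (meson lessThan_iff sum.neutral)
        then show "x \<in> (\<Union>i<n. ball (c i) (r i))"
          using pos[of i x] nn[of i x] by force
      qed
    qed
    show "(\<lambda>n. \<eta> n x) \<longlonglongrightarrow> indicator \<Omega> x" for x
    proof (cases "x \<in> \<Omega>")
      case True
      then obtain k where k: "b k x > 0"
        using \<Omega> pos by blast
      have "filterlim (\<lambda>n. real n * b k x) at_top sequentially"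
        by (rule filterlim_at_top_mult_tendsto_pos[OF tendsto_const k filterlim_real_sequentially])
      moreover have "\<forall>\<^sub>F n in sequentially. real n * b k x \<le> real n * (\<Sum>i<n. b i x)"
        using eventually_gt_at_top[of k]
        by eventually_elim (intro mult_left_mono member_le_sum, auto simp: nn)
      ultimately have "filterlim (\<lambda>n. real n * (\<Sum>i<n. b i x)) at_top sequentially"
        by (rule filterlim_at_top_mono)
      then have "(\<lambda>n. exp (- (real n * (\<Sum>i<n. b i x)))) \<longlonglongrightarrow> 0"
        by (intro filterlim_compose[OF exp_at_bot] filterlim_compose[OF filterlim_uminus_at_bot_at_top])
      from tendsto_diff[OF tendsto_const this, of 1] show ?thesis
        unfolding \<eta>_def using True by simp
    next
      case False
      then have "b i x = 0" for i
        using \<Omega> pos[of i x] nn[of i x] by force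
      then show ?thesis
        using False by (simp add: \<eta>_def)
    qed
  qed
qed

text \<open>For a field of constant direction \<open>y\<close> the divergence is the derivative of the scalar factor along
\<open>y\<close>: this turns the perimeter into a bound on directional derivatives.\<close>

lemma divergence_scaleR_const:
  fixes \<eta> :: "real^'d \<Rightarrow> real"
  assumes "(\<eta> has_derivative D) (at x)"
  shows "divergence (\<lambda>x. \<eta> x *\<^sub>R y) x = D y"
    and "frechet_derivative (\<lambda>x. \<eta> x *\<^sub>R y) (at x) = (\<lambda>v. D v *\<^sub>R y)"
proof -
  have "((\<lambda>x. \<eta> x *\<^sub>R y) has_derivative (\<lambda>v. D v *\<^sub>R y)) (at x)"
    using assms by (auto intro!: derivative_eq_intros)
  then show fd: "frechet_derivative (\<lambda>x. \<eta> x *\<^sub>R y) (at x) = (\<lambda>v. D v *\<^sub>R y)"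
    by (metis frechet_derivative_at)
  interpret D: linear D
    using assms by (simp add: has_derivative_linear)
  have "divergence (\<lambda>x. \<eta> x *\<^sub>R y) x = (\<Sum>i\<in>UNIV. D ((y $ i) *\<^sub>R axis i 1))"
    unfolding divergence_def fd by (simp add: D.scaleR mult.commute)
  also have "\<dots> = D y"
    unfolding D.sum[symmetric] by (simp add: basis_expansion scalar_mult_eq_scaleR[symmetric])
  finally show "divergence (\<lambda>x. \<eta> x *\<^sub>R y) x = D y" .
qed

lemma directional_integral_le_perimeter:
  fixes \<Omega> :: "(real^'d) set"
  assumes per: "perimeter \<Omega> \<le> ereal P"
    and d: "\<And>x. (\<eta> has_derivative \<eta>' x) (at x)"
    and c: "\<And>v. continuous_on UNIV (\<lambda>x. \<eta>' x v)"
    and bd: "bounded {x. \<eta> x \<noteq> 0}"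
    and le: "\<And>x. \<bar>\<eta> x\<bar> \<le> (1::real)"
  shows "(LINT x:\<Omega>|lborel. \<eta>' x y) \<le> P * norm y"
proof (cases "y = 0")
  case True
  have "\<eta>' x 0 = 0" for x
    using d[of x] by (meson has_derivative_linear linear_0)
  then show ?thesis
    using True by (simp add: set_lebesgue_integral_def)
next
  case False
  define e where "e = y /\<^sub>R norm y"
  have ne: "norm e = 1" and y: "y = norm y *\<^sub>R e"
    using False by (auto simp: e_def)
  have "(\<lambda>x. \<eta> x *\<^sub>R e) \<in> {\<phi> \<in> C1_compact_support. \<forall>x. norm (\<phi> x) \<le> 1}"
  proof -
    have "(\<lambda>x. \<eta> x *\<^sub>R e) differentiable (at x)" for x
      using d[of x] by (intro differentiable_scaleR) (auto simp: differentiable_def)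
    moreover have "{x. \<eta> x *\<^sub>R e \<noteq> 0} = {x. \<eta> x \<noteq> 0}"
      using ne by auto
    ultimately show ?thesis
      using ne c bd le
      by (auto simp: C1_compact_support_def divergence_scaleR_const(2)[OF d] compact_closure
          intro!: continuous_intros)
  qed
  then have "ereal (LINT x:\<Omega>|lborel. divergence (\<lambda>x. \<eta> x *\<^sub>R e) x) \<le> perimeter \<Omega>"
    unfolding perimeter_def by (rule SUP_upper)
  then have "(LINT x:\<Omega>|lborel. \<eta>' x e) \<le> P"
    using order_trans[OF _ per, of "ereal (LINT x:\<Omega>|lborel. \<eta>' x e)"]
    by (simp add: divergence_scaleR_const(1)[OF d])
  then have "norm y * (LINT x:\<Omega>|lborel. \<eta>' x e) \<le> norm y * P"
    by (intro mult_left_mono) auto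
  moreover have "\<eta>' x y = norm y * \<eta>' x e" for x
    using linear_scale[OF has_derivative_linear[OF d, of x], of "norm y" e] y by simp
  ultimately show ?thesis
    by (simp add: mult.commute)
qed

text \<open>The difference \<open>\<eta> (x + y) - \<eta> x\<close> is the integral of the directional derivative along the segment,
and the translates of \<open>\<eta>\<close> met on the way are test functions as well.\<close>

lemma shift_difference_le_perimeter:
  fixes \<Omega> :: "(real^'d) set"
  assumes fin: "emeasure lborel \<Omega> < \<infinity>" and \<Omega>[measurable]: "\<Omega> \<in> sets borel"
    and per: "perimeter \<Omega> \<le> ereal P"
    and d: "\<And>x. (\<eta> has_derivative \<eta>' x) (at x)"
    and c: "\<And>v. continuous_on UNIV (\<lambda>x. \<eta>' x v)"
    and bd: "bounded {x. \<eta> x \<noteq> 0}"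
    and le: "\<And>x. \<bar>\<eta> x\<bar> \<le> (1::real)"
  shows "(LINT x:\<Omega>|lborel. \<eta> (x + y) - \<eta> x) \<le> P * norm y"
proof -
  obtain B where B: "\<And>x. \<bar>\<eta>' x y\<bar> \<le> B"
  proof -
    let ?K = "closure {x. \<eta> x \<noteq> 0}"
    have "bounded ((\<lambda>x. \<eta>' x y) ` ?K)"
      by (intro compact_imp_bounded compact_continuous_image continuous_on_subset[OF c])
        (use bd in \<open>auto simp: compact_closure\<close>)
    then obtain B where B: "\<And>x. x \<in> ?K \<Longrightarrow> \<bar>\<eta>' x y\<bar> \<le> B"
      by (force simp: bounded_iff)
    have out: "\<eta>' x y = 0" if "x \<notin> ?K" for x
    proof -
      have "(\<eta> has_derivative (\<lambda>_. 0)) (at x)"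
        by (rule has_derivative_transform_within_open[of "\<lambda>_. 0" _ _ _ "- ?K"])
          (use that closure_subset[of "{x. \<eta> x \<noteq> 0}"] in auto)
      then show ?thesis
        using has_derivative_unique[OF d] by metis
    qed
    show thesis
      by (rule that[of "max B 0"]) (use B out in \<open>force simp: le_max_iff_disj\<close>)
  qed
  have [measurable]: "(\<lambda>x. \<eta>' x y) \<in> borel_measurable borel"
    using c by (rule borel_measurable_continuous_onI)
  define I where "I s x = indicator {0..1::real} s * (indicator \<Omega> x * \<eta>' (x + s *\<^sub>R y) y)" for s x
  have ftc: "(LINT s|lborel. I s x) = indicator \<Omega> x * (\<eta> (x + y) - \<eta> x)" for x
  proof -
    have "has_bochner_integral lborel (\<lambda>s. \<eta>' (x + s *\<^sub>R y) y * indicator {0..1} s)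
        (\<eta> (x + 1 *\<^sub>R y) - \<eta> (x + 0 *\<^sub>R y))"
    proof (rule has_bochner_integral_FTC_Icc_real)
      show "((\<lambda>s. \<eta> (x + s *\<^sub>R y)) has_real_derivative \<eta>' (x + s *\<^sub>R y) y) (at s)" for s
      proof -
        have "((\<lambda>s. x + s *\<^sub>R y) has_derivative (\<lambda>h. h *\<^sub>R y)) (at s)"
          by (auto intro!: derivative_eq_intros)
        from has_derivative_compose[OF this d] show ?thesis
          unfolding has_field_derivative_def
          using linear_scale[OF has_derivative_linear[OF d, of "x + s *\<^sub>R y"]]
          by (simp add: mult.commute mult_commute_abs)
      qed
      have "continuous_on UNIV (\<lambda>s. \<eta>' (x + s *\<^sub>R y) y)"
        by (rule continuous_on_compose2[OF c]) (auto intro!: continuous_intros)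
      then show "isCont (\<lambda>s. \<eta>' (x + s *\<^sub>R y) y) s" for s
        by (simp add: continuous_on_eq_continuous_at)
    qed simp
    from has_bochner_integral_integral_eq[OF has_bochner_integral_mult_right[OF this, of "indicator \<Omega> x"]]
    show ?thesis
      unfolding I_def by (simp add: mult_ac)
  qed
  have int\<Omega>: "integrable lborel (\<lambda>x. B * indicator \<Omega> x)"
    using fin by (intro integrable_mult_right) auto
  have int01: "integrable lborel (indicator {0..1} :: real \<Rightarrow> real)"
    by auto
  have dom: "norm (I s x) \<le> indicator {0..1} s * (B * indicator \<Omega> x)" for s x
    using B by (auto simp: I_def indicator_def)
  have meas: "(\<lambda>(s, x). I s x) \<in> borel_measurable (lborel \<Otimes>\<^sub>M lborel)"
    unfolding I_def by measurable
  have "(LINT x:\<Omega>|lborel. \<eta> (x + y) - \<eta> x) = (LINT x|lborel. LINT s|lborel. I s x)"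
    by (simp add: ftc set_lebesgue_integral_def)
  also have "\<dots> = (LINT s|lborel. LINT x|lborel. I s x)"
    by (rule fubini_swap_dominated(1)[OF _ _ meas int01 int\<Omega> dom]) (auto intro: sigma_finite_lborel)
  also have "\<dots> \<le> (LINT s|lborel. indicator {0..1::real} s * (P * norm y))"
  proof (rule integral_mono)
    show "integrable lborel (\<lambda>s. LINT x|lborel. I s x)"
      by (rule fubini_swap_dominated(3)[OF _ _ meas int01 int\<Omega> dom]) (auto intro: sigma_finite_lborel)
    show "integrable lborel (\<lambda>s. indicator {0..1::real} s * (P * norm y))"
      by auto
    fix s :: real
    have "(LINT x:\<Omega>|lborel. \<eta>' (x + s *\<^sub>R y) y) \<le> P * norm y"
    proof (rule directional_integral_le_perimeter[OF per, where \<eta> = "\<lambda>x. \<eta> (x + s *\<^sub>R y)" and \<eta>' = "\<lambda>x. \<eta>' (x + s *\<^sub>R y)"])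
      show "((\<lambda>x. \<eta> (x + s *\<^sub>R y)) has_derivative \<eta>' (x + s *\<^sub>R y)) (at x)" for x
        by (rule has_derivative_compose[OF _ d, of "\<lambda>x. x + s *\<^sub>R y" "\<lambda>v. v", simplified])
          (auto intro!: derivative_eq_intros)
      show "continuous_on UNIV (\<lambda>x. \<eta>' (x + s *\<^sub>R y) v)" for v
        by (rule continuous_on_compose2[OF c]) (auto intro!: continuous_intros)
      have "{x. \<eta> (x + s *\<^sub>R y) \<noteq> 0} = (\<lambda>x. - (s *\<^sub>R y) + x) ` {x. \<eta> x \<noteq> 0}"
        by (force simp: image_iff algebra_simps intro: exI[of _ "_ + s *\<^sub>R y"])
      then show "bounded {x. \<eta> (x + s *\<^sub>R y) \<noteq> 0}"
        using bounded_translation[OF bd, of "- (s *\<^sub>R y)"] by simp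
    qed (rule le)
    then show "(LINT x|lborel. I s x) \<le> indicator {0..1::real} s * (P * norm y)"
      by (auto simp: I_def indicator_def set_lebesgue_integral_def)
  qed
  finally show ?thesis
    by simp
qed

lemma borel_translate_vimage [measurable, simp]:
  fixes S :: "'a::euclidean_space set"
  assumes "S \<in> sets borel"
  shows "(\<lambda>x. x - y) -` S \<in> sets borel"
  using measurable_sets_borel[of "\<lambda>x. x - y" borel S] assms by simp

lemma emeasure_lborel_translate:
  fixes S :: "'a::euclidean_space set"
  assumes [measurable]: "S \<in> sets borel"
  shows "emeasure lborel ((\<lambda>x. x - y) -` S) = emeasure lborel S"
proof -
  have "emeasure lborel S = emeasure (distr lborel borel ((+) (- y))) S"
    by (simp only: lborel_distr_plus)
  also have "\<dots> = emeasure lborel ((\<lambda>x. - y + x) -` S)"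
    by (subst emeasure_distr) auto
  finally show ?thesis
    by simp
qed

lemma measure_lborel_translate:
  fixes S :: "'a::euclidean_space set"
  assumes "S \<in> sets borel"
  shows "measure lborel ((\<lambda>x. x - y) -` S) = measure lborel S"
  using emeasure_lborel_translate[OF assms] by (simp add: measure_def)

lemma image_translate_eq_vimage: "(\<lambda>x. x + y) ` S = (\<lambda>x. x - y) -` (S :: 'a::ab_group_add set)"
  by (force simp: image_iff)

context
  fixes \<Omega> :: "(real^'d) set"
  assumes borel_\<Omega>[measurable]: "\<Omega> \<in> sets borel"
    and finite_\<Omega>: "emeasure lborel \<Omega> < \<infinity>"
begin

lemma fmeasurable_translate: "(\<lambda>x. x - y) -` \<Omega> \<in> fmeasurable lborel"
  using finite_\<Omega> emeasure_lborel_translate[OF borel_\<Omega>, of y]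
  by (intro fmeasurableI) auto

lemma fmeasurable_self: "\<Omega> \<in> fmeasurable lborel"
  using fmeasurable_translate[of 0] by simp

lemma covariance_fun_eq: "covariance_fun \<Omega> y = measure lborel (\<Omega> \<inter> (\<lambda>z. z - y) -` \<Omega>)"
  by (simp add: covariance_fun_def image_translate_eq_vimage)

lemma covariance_fun_nonneg: "0 \<le> covariance_fun \<Omega> y"
  by (simp add: covariance_fun_def)

text \<open>The deficit \<open>g 0 - g (y - x)\<close> of the covariance function is the measure of the part of \<open>\<Omega> + x\<close> outside
\<open>\<Omega> + y\<close>; estimates for the covariance function become set inclusions.\<close>

lemma covariance_fun_deficit:
  "covariance_fun \<Omega> 0 - covariance_fun \<Omega> (y - x) =
    measure lborel ((\<lambda>z. z - x) -` \<Omega> - (\<lambda>z. z - y) -` \<Omega>)"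
proof -
  let ?T = "(\<lambda>z. z - x) -` \<Omega> - (\<lambda>z. z - y) -` \<Omega>"
  have "measure lborel ?T = measure lborel ((\<lambda>z. z - (- x)) -` ?T)"
    by (rule measure_lborel_translate[symmetric]) measurable
  also have "(\<lambda>z. z - (- x)) -` ?T = \<Omega> - (\<Omega> \<inter> (\<lambda>z. z - (y - x)) -` \<Omega>)"
    by (auto simp: algebra_simps)
  also have "measure lborel \<dots> = measure lborel \<Omega> - measure lborel (\<Omega> \<inter> (\<lambda>z. z - (y - x)) -` \<Omega>)"
    by (rule measurable_measure_Diff) (auto simp: fmeasurable_self intro!: fmeasurableD)
  finally show ?thesis
    by (simp add: covariance_fun_eq)
qed

lemma covariance_fun_le_0: "covariance_fun \<Omega> y \<le> covariance_fun \<Omega> 0"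
  using covariance_fun_deficit[of y 0] by (metis diff_ge_0_iff_ge diff_zero measure_nonneg)

lemma covariance_fun_uminus: "covariance_fun \<Omega> (- y) = covariance_fun \<Omega> y"
proof -
  have "measure lborel (\<Omega> \<inter> (\<lambda>z. z - (- y)) -` \<Omega>) =
      measure lborel ((\<lambda>z. z - y) -` (\<Omega> \<inter> (\<lambda>z. z - (- y)) -` \<Omega>))"
    by (rule measure_lborel_translate[symmetric]) measurable
  also have "(\<lambda>z. z - y) -` (\<Omega> \<inter> (\<lambda>z. z - (- y)) -` \<Omega>) = \<Omega> \<inter> (\<lambda>z. z - y) -` \<Omega>"
    by auto
  finally show ?thesis
    unfolding covariance_fun_eq .
qed

text \<open>Modulus of continuity at any point is controlled by the one at the origin:
\<open>\<Omega> \<inter> (\<Omega> + x) \<subseteq> \<Omega> \<inter> (\<Omega> + y) \<union> ((\<Omega> + x) - (\<Omega> + y))\<close>.\<close>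

lemma covariance_fun_diff_le:
  "\<bar>covariance_fun \<Omega> x - covariance_fun \<Omega> y\<bar> \<le> covariance_fun \<Omega> 0 - covariance_fun \<Omega> (x - y)"
proof -
  have "covariance_fun \<Omega> x - covariance_fun \<Omega> y \<le> covariance_fun \<Omega> 0 - covariance_fun \<Omega> (y - x)" for x y
  proof -
    let ?X = "(\<lambda>z. z - x) -` \<Omega>" and ?Y = "(\<lambda>z. z - y) -` \<Omega>"
    have fm: "\<Omega> \<inter> ?Y \<in> fmeasurable lborel" "?X - ?Y \<in> fmeasurable lborel"
      by (auto intro!: fmeasurable_Int_fmeasurable fmeasurable_Diff fmeasurable_translate fmeasurable_self
fmeasurableD)
    have "measure lborel (\<Omega> \<inter> ?X) \<le> measure lborel (\<Omega> \<inter> ?Y \<union> (?X - ?Y))"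
      by (rule measure_mono_fmeasurable) (use fm in \<open>auto intro!: fmeasurable.Un measurable_sets_borel\<close>)
    also have "\<dots> \<le> measure lborel (\<Omega> \<inter> ?Y) + measure lborel (?X - ?Y)"
      by (rule measure_Un_le) (use fm in auto)
    finally show ?thesis
      unfolding covariance_fun_deficit by (simp add: covariance_fun_eq)
  qed
  from this[of x y] this[of y x] show ?thesis
    using covariance_fun_uminus[of "x - y"] by auto
qed

lemma covariance_fun_deficit_eq:
  "covariance_fun \<Omega> 0 - covariance_fun \<Omega> y = measure lborel {x \<in> \<Omega>. x + y \<notin> \<Omega>}"
proof -
  have "covariance_fun \<Omega> 0 - covariance_fun \<Omega> y = covariance_fun \<Omega> 0 - covariance_fun \<Omega> (- y - 0)"
    by (simp add: covariance_fun_uminus)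
  also have "\<dots> = measure lborel {x \<in> \<Omega>. x + y \<notin> \<Omega>}"
    unfolding covariance_fun_deficit by (rule arg_cong[where f = "measure lborel"]) auto
  finally show ?thesis .
qed

text \<open>Up to small measure \<open>\<Omega>\<close> lies in a ball, and a shift longer than the diameter moves the ball off
itself.\<close>

lemma covariance_fun_tendsto_0: "(covariance_fun \<Omega> \<longlongrightarrow> 0) at_infinity"
proof (rule tendstoI)
  fix e :: real assume e: "0 < e"
  have "(\<lambda>n. measure lborel (\<Omega> \<inter> - cball 0 (real n))) \<longlonglongrightarrow> measure lborel (\<Inter>n. \<Omega> \<inter> - cball 0 (real n))"
  proof (rule Lim_measure_decseq)
    show "emeasure lborel (\<Omega> \<inter> - cball 0 (real n)) \<noteq> \<infinity>" for n
      using emeasure_mono[of "\<Omega> \<inter> - cball 0 (real n)" \<Omega> lborel] finite_\<Omega> by (auto simp: top_unique)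
  qed (auto simp: decseq_def)
  also have "(\<Inter>n. \<Omega> \<inter> - cball 0 (real n)) = {}"
  proof -
    have "x \<notin> (\<Inter>n. \<Omega> \<inter> - cball 0 (real n))" for x :: "real^'d"
      using real_arch_simple[of "norm x"] by auto
    then show ?thesis by blast
  qed
  finally have "\<forall>\<^sub>F n in sequentially. measure lborel (\<Omega> \<inter> - cball 0 (real n)) < e / 2"
    using e by (intro order_tendstoD(2)[where y = 0]) auto
  then obtain n where n: "measure lborel (\<Omega> \<inter> - cball 0 (real n)) < e / 2"
    by (auto simp: eventually_sequentially)
  have "covariance_fun \<Omega> y < e" if y: "2 * real n + 1 \<le> norm y" for y
  proof -
    let ?S = "\<Omega> \<inter> - cball 0 (real n)"
    have fm: "?S \<in> fmeasurable lborel" "(\<lambda>z. z - y) -` ?S \<in> fmeasurable lborel"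
      by (auto simp: vimage_Int intro!: fmeasurable_Int_fmeasurable fmeasurable_translate fmeasurable_self)
    have "x \<in> ?S \<union> (\<lambda>z. z - y) -` ?S" if x: "x \<in> \<Omega>" "x - y \<in> \<Omega>" for x
    proof -
      have "norm y \<le> norm x + norm (x - y)"
        using norm_triangle_ineq4[of x "x - y"] by simp
      then have "\<not> (norm x \<le> real n \<and> norm (x - y) \<le> real n)"
        using y by auto
      then show ?thesis using x by auto
    qed
    then have "covariance_fun \<Omega> y \<le> measure lborel (?S \<union> (\<lambda>z. z - y) -` ?S)"
      unfolding covariance_fun_eq
      by (intro measure_mono_fmeasurable) (use fm in \<open>auto intro!: fmeasurable.Un measurable_sets_borel\<close>)
    also have "\<dots> \<le> measure lborel ?S + measure lborel ((\<lambda>z. z - y) -` ?S)"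
      by (rule measure_Un_le) (use fm in auto)
    also have "measure lborel ((\<lambda>z. z - y) -` ?S) = measure lborel ?S"
      by (rule measure_lborel_translate) auto
    finally show ?thesis using n by simp
  qed
  then show "\<forall>\<^sub>F y in at_infinity. dist (covariance_fun \<Omega> y) 0 < e"
    unfolding eventually_at_infinity using covariance_fun_nonneg by auto
qed

text \<open>The shift estimate is applied to the negatives of the bumps converging to the indicator of \<open>\<Omega>\<close>;
with this sign the limit of the left-hand sides is the measure of the points of \<open>\<Omega>\<close> that leave \<open>\<Omega>\<close>.\<close>

lemma covariance_fun_shift_le:
  assumes op: "open \<Omega>" "\<Omega> \<noteq> {}" and per: "perimeter \<Omega> \<le> ereal P"
  shows "covariance_fun \<Omega> 0 - covariance_fun \<Omega> y \<le> P * norm y"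
proof -
  obtain \<eta> :: "nat \<Rightarrow> real^'d \<Rightarrow> real" and \<eta>' where \<eta>: "\<And>n x. 0 \<le> \<eta> n x \<and> \<eta> n x \<le> 1"
      "\<And>n x. (\<eta> n has_derivative \<eta>' n x) (at x)"
      "\<And>n v. continuous_on UNIV (\<lambda>x. \<eta>' n x v)"
      "\<And>n. bounded {x. \<eta> n x \<noteq> 0}"
    and lim: "\<And>x. (\<lambda>n. \<eta> n x) \<longlonglongrightarrow> indicator \<Omega> x"
    by (rule open_indicator_limit_of_C1_bumps[OF op]) blast
  have "continuous_on UNIV (\<eta> n)" for n
    by (meson \<eta>(2) continuous_at_imp_continuous_on has_derivative_continuous)
  then have [measurable]: "\<eta> n \<in> borel_measurable borel" for n
    by (rule borel_measurable_continuous_onI)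
  have le: "(LINT x:\<Omega>|lborel. - \<eta> n (x + y) - - \<eta> n x) \<le> P * norm y" for n
    by (rule shift_difference_le_perimeter[OF finite_\<Omega> borel_\<Omega> per, of "\<lambda>x. - \<eta> n x" "\<lambda>x v. - \<eta>' n x v"])
      (use \<eta> in \<open>auto intro!: has_derivative_minus continuous_intros\<close>)
  have "(\<lambda>n. LINT x:\<Omega>|lborel. - \<eta> n (x + y) - - \<eta> n x) \<longlonglongrightarrow>
      (LINT x:\<Omega>|lborel. - indicator \<Omega> (x + y) - - indicator \<Omega> x)"
    unfolding set_lebesgue_integral_def
  proof (rule integral_dominated_convergence[where w = "\<lambda>x. indicator \<Omega> x"])
    show "integrable lborel (indicator \<Omega> :: _ \<Rightarrow> real)"
      using finite_\<Omega> by auto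
    show "AE x in lborel. (\<lambda>n. indicat_real \<Omega> x *\<^sub>R (- \<eta> n (x + y) - - \<eta> n x)) \<longlonglongrightarrow>
        indicat_real \<Omega> x *\<^sub>R (- indicator \<Omega> (x + y) - - indicator \<Omega> x)"
      by (intro AE_I2 tendsto_intros lim)
    show "AE x in lborel. norm (indicat_real \<Omega> x *\<^sub>R (- \<eta> n (x + y) - - \<eta> n x)) \<le> indicat_real \<Omega> x" for n
    proof (rule AE_I2)
      fix x
      show "norm (indicat_real \<Omega> x *\<^sub>R (- \<eta> n (x + y) - - \<eta> n x)) \<le> indicat_real \<Omega> x"
        using \<eta>(1)[of n x] \<eta>(1)[of n "x + y"] by (auto simp: indicator_def)
    qed
  qed measurable
  then have "(LINT x:\<Omega>|lborel. - indicator \<Omega> (x + y) - - indicator \<Omega> x) \<le> P * norm y"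
    by (rule LIMSEQ_le_const2) (use le in auto)
  also have "(LINT x:\<Omega>|lborel. - indicator \<Omega> (x + y) - - indicator \<Omega> x) =
      (LINT x|lborel. indicat_real {x \<in> \<Omega>. x + y \<notin> \<Omega>} x)"
    unfolding set_lebesgue_integral_def
    by (rule Bochner_Integration.integral_cong) (auto simp: indicator_def)
  also have "\<dots> = measure lborel {x \<in> \<Omega>. x + y \<notin> \<Omega>}"
    by simp
  finally show ?thesis
    by (simp add: covariance_fun_deficit_eq)
qed

end

section \<open>Hoelder functions and the jump operator\<close>

text \<open>Powers of the truncated norm serve both as integrands against the jump measure and as moduli of
continuity. With such a modulus, one constant controls the oscillation and the local Hoelder
seminorm of a function together.\<close>

definition tnorm :: "'a::real_normed_vector \<Rightarrow> real" where
  "tnorm z = min 1 (norm z)"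

lemma tnorm_nonneg [simp]: "0 \<le> tnorm z" and tnorm_le_1 [simp]: "tnorm z \<le> 1"
  and tnorm_le_norm: "tnorm z \<le> norm z" and tnorm_0 [simp]: "tnorm 0 = 0"
  and tnorm_minus [simp]: "tnorm (- z) = tnorm z"
  by (auto simp: tnorm_def)

lemma tnorm_pos_iff [simp]: "0 < tnorm z \<longleftrightarrow> z \<noteq> 0"
  by (auto simp: tnorm_def)

lemma borel_measurable_tnorm [measurable]:
  "tnorm \<in> borel_measurable (borel :: 'a::{real_normed_vector, second_countable_topology} measure)"
  unfolding tnorm_def by measurable

definition holder :: "real \<Rightarrow> real \<Rightarrow> ('a::real_normed_vector \<Rightarrow> real) \<Rightarrow> bool" where
  "holder \<beta> K f \<longleftrightarrow> (\<forall>x y. \<bar>f x - f y\<bar> \<le> K * tnorm (x - y) powr \<beta>)"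

lemma holderD: "holder \<beta> K f \<Longrightarrow> \<bar>f x - f y\<bar> \<le> K * tnorm (x - y) powr \<beta>"
  by (simp add: holder_def)

lemma tnorm_tendsto_0: "((\<lambda>y. tnorm (y - x)) \<longlongrightarrow> 0) (at x)"
  by (rule Lim_null_comparison[of _ "\<lambda>y. norm (y - x)"])
    (auto intro!: always_eventually tnorm_le_norm tendsto_eq_intros)

lemma holder_continuous:
  assumes "holder \<beta> K f" "0 < \<beta>"
  shows "continuous_on UNIV f"
proof -
  have "(f \<longlongrightarrow> f x) (at x)" for x
  proof (rule LIM_zero_cancel, rule Lim_null_comparison)
    show "\<forall>\<^sub>F y in at x. norm (f y - f x) \<le> K * tnorm (y - x) powr \<beta>"
      using holderD[OF assms(1)] by (auto intro: always_eventually)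
    have "((\<lambda>y. tnorm (y - x) powr \<beta>) \<longlongrightarrow> 0) (at x)"
      by (rule tendsto_zero_powrI[OF tnorm_tendsto_0 tendsto_const _ assms(2)]) auto
    from tendsto_mult_right_zero[OF this] show "((\<lambda>y. K * tnorm (y - x) powr \<beta>) \<longlongrightarrow> 0) (at x)" .
  qed
  then show ?thesis
    by (simp add: continuous_on_eq_continuous_at isCont_def)
qed

lemma holder_measurable:
  fixes f :: "'a::{real_normed_vector, second_countable_topology} \<Rightarrow> real"
  assumes "holder \<beta> K f" "0 < \<beta>"
  shows "f \<in> borel_measurable borel"
  using holder_continuous[OF assms] by (rule borel_measurable_continuous_onI)

definition jump_op :: "'a measure \<Rightarrow> ('a::ab_group_add \<Rightarrow> 'b::{banach, second_countable_topology}) \<Rightarrow> 'a \<Rightarrow> 'b" where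
  "jump_op \<nu> f x = (LINT y|\<nu>. f (x + y) - f x)"

locale levy_measure =
  fixes \<nu> :: "(real^'d) measure"
  assumes sets_nu [measurable_cong]: "sets \<nu> = sets borel"
    and nu_zero: "emeasure \<nu> {0} = 0"
    and nu_int: "(\<integral>\<^sup>+z. ennreal (min 1 (norm z)) \<partial>\<nu>) < \<infinity>"
begin

lemma space_nu [simp]: "space \<nu> = UNIV"
  using sets_eq_imp_space_eq[OF sets_nu] by simp

lemma integrable_tnorm: "integrable \<nu> tnorm"
  using nu_int by (intro integrableI_bounded) (auto simp: tnorm_def)

text \<open>The sets where the truncated norm is at least \<open>1 / (n + 1)\<close> have finite measure, and they cover
everything except the origin, which is a null set.\<close>

lemma sigma_finite_nu: "sigma_finite_measure \<nu>"
proof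
  let ?A = "\<lambda>n::nat. {z \<in> UNIV. 1 \<le> of_nat (Suc n) * ennreal (tnorm z)}"
  have fin: "emeasure \<nu> (?A n) \<noteq> \<infinity>" for n
  proof -
    have "emeasure \<nu> (?A n) \<le> of_nat (Suc n) * (\<integral>\<^sup>+z. ennreal (tnorm z) * indicator UNIV z \<partial>\<nu>)"
      by (rule nn_integral_Markov_inequality) auto
    also have "\<dots> < \<infinity>"
      using nu_int by (auto simp: tnorm_def ennreal_mult_less_top of_nat_less_top simp del: of_nat_Suc)
    finally show ?thesis by simp
  qed
  have cover: "z \<in> {0} \<union> (\<Union>n. ?A n)" for z
  proof (cases "z = 0")
    case False
    then obtain n where "inverse (real (Suc n)) < tnorm z"
      using reals_Archimedean[of "tnorm z"] by auto
    then have "1 \<le> real (Suc n) * tnorm z"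
      by (simp add: field_simps)
    then have "ennreal 1 \<le> ennreal (real (Suc n) * tnorm z)"
      by (rule ennreal_leI)
    then have "1 \<le> of_nat (Suc n) * ennreal (tnorm z)"
      by (simp add: ennreal_mult ennreal_of_nat_eq_real_of_nat[symmetric] del: of_nat_Suc)
    then show ?thesis by auto
  qed simp
  have meas: "?A n \<in> sets \<nu>" for n
    by measurable
  show "\<exists>A. countable A \<and> A \<subseteq> sets \<nu> \<and> \<Union> A = space \<nu> \<and> (\<forall>a\<in>A. emeasure \<nu> a \<noteq> \<infinity>)"
    using fin meas nu_zero cover by (intro exI[of _ "insert {0} (range ?A)"]) auto
qed

lemma
  assumes f: "holder \<beta> K f" "0 < \<beta>" and m: "integrable \<nu> (\<lambda>z. tnorm z powr \<beta>)"
  shows integrable_increment: "integrable \<nu> (\<lambda>y. f (x + y) - f x)"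
    and jump_op_bound: "\<bar>jump_op \<nu> f x\<bar> \<le> K * (LINT z|\<nu>. tnorm z powr \<beta>)"
proof -
  note [measurable] = holder_measurable[OF f]
  have le: "\<bar>f (x + y) - f x\<bar> \<le> K * tnorm y powr \<beta>" for y
    using holderD[OF f(1), of "x + y" x] by simp
  show int: "integrable \<nu> (\<lambda>y. f (x + y) - f x)"
    by (rule Bochner_Integration.integrable_bound[OF integrable_mult_right[OF m, of K]])
      (use le in \<open>auto intro: order_trans[OF _ abs_ge_self]\<close>)
  have "\<bar>jump_op \<nu> f x\<bar> \<le> (LINT y|\<nu>. \<bar>f (x + y) - f x\<bar>)"
    unfolding jump_op_def by (rule integral_abs_bound)
  also have "\<dots> \<le> (LINT y|\<nu>. K * tnorm y powr \<beta>)"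
    by (rule integral_mono) (use int m le in auto)
  finally show "\<bar>jump_op \<nu> f x\<bar> \<le> K * (LINT z|\<nu>. tnorm z powr \<beta>)"
    by simp
qed

text \<open>An increment of \<open>f\<close> by \<open>y\<close>, compared at \<open>x\<close> and at \<open>x'\<close>, is at most \<open>2 K\<close> times the \<open>\<beta>\<close>-th power of
either \<open>tnorm y\<close> or \<open>tnorm (x - x')\<close>. Of the smaller of these two, the power \<open>\<epsilon>\<close> is charged to \<open>y\<close> and
integrated, and the rest is left as the modulus of continuity of the image.\<close>

lemma jump_op_holder:
  assumes f: "holder \<beta> K f" and K: "0 \<le> K" and \<epsilon>: "0 < \<epsilon>" "\<epsilon> \<le> \<beta>"
    and m: "integrable \<nu> (\<lambda>z. tnorm z powr \<epsilon>)"
  shows "holder (\<beta> - \<epsilon>) (2 * K * (LINT z|\<nu>. tnorm z powr \<epsilon>)) (jump_op \<nu> f)"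
  unfolding holder_def
proof (intro allI)
  fix x x'
  have \<beta>: "0 < \<beta>" using \<epsilon> by simp
  note [measurable] = holder_measurable[OF f \<beta>]
  have m\<beta>: "integrable \<nu> (\<lambda>z. tnorm z powr \<beta>)"
    by (rule Bochner_Integration.integrable_bound[OF m]) (use \<epsilon> in \<open>auto intro!: powr_mono'\<close>)
  have int: "integrable \<nu> (\<lambda>y. f (x + y) - f x)" for x
    by (rule integrable_increment[OF f \<beta> m\<beta>])
  have le: "\<bar>(f (x + y) - f x) - (f (x' + y) - f x')\<bar> \<le> 2 * K * tnorm (x - x') powr (\<beta> - \<epsilon>) * tnorm y powr \<epsilon>" for y
  proof -
    let ?a = "tnorm y" and ?b = "tnorm (x - x')"
    have "\<bar>(f (x + y) - f x) - (f (x' + y) - f x')\<bar> \<le> 2 * K * ?a powr \<beta>"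
      using holderD[OF f, of "x + y" x] holderD[OF f, of "x' + y" x'] by simp
    moreover have "\<bar>(f (x + y) - f x) - (f (x' + y) - f x')\<bar> \<le> 2 * K * ?b powr \<beta>"
      using holderD[OF f, of "x + y" "x' + y"] holderD[OF f, of x x'] by simp
    ultimately have "\<bar>(f (x + y) - f x) - (f (x' + y) - f x')\<bar> \<le> 2 * K * (min ?a ?b) powr \<beta>"
      by (simp add: min_def)
    also have "(min ?a ?b) powr \<beta> = (min ?a ?b) powr (\<beta> - \<epsilon>) * (min ?a ?b) powr \<epsilon>"
      by (simp add: powr_add[symmetric])
    also have "\<dots> \<le> ?b powr (\<beta> - \<epsilon>) * ?a powr \<epsilon>"
      using \<epsilon> by (intro mult_mono powr_mono2) auto
    finally show ?thesis
      using K by (simp add: mult.assoc mult_left_mono)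
  qed
  have "\<bar>jump_op \<nu> f x - jump_op \<nu> f x'\<bar> = \<bar>LINT y|\<nu>. (f (x + y) - f x) - (f (x' + y) - f x')\<bar>"
    unfolding jump_op_def using int by (subst Bochner_Integration.integral_diff) auto
  also have "\<dots> \<le> (LINT y|\<nu>. \<bar>(f (x + y) - f x) - (f (x' + y) - f x')\<bar>)"
    by (rule integral_abs_bound)
  also have "\<dots> \<le> (LINT y|\<nu>. 2 * K * tnorm (x - x') powr (\<beta> - \<epsilon>) * tnorm y powr \<epsilon>)"
    by (rule integral_mono) (use int m le in auto)
  finally show "\<bar>jump_op \<nu> f x - jump_op \<nu> f x'\<bar> \<le> 2 * K * (LINT z|\<nu>. tnorm z powr \<epsilon>) * tnorm (x - x') powr (\<beta> - \<epsilon>)"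
    by (simp add: mult_ac)
qed

text \<open>Dominated convergence, with functions and base points both allowed to vary: moving base points
give decay at infinity, varying functions give stability under approximation.\<close>

lemma jump_op_tendsto:
  assumes fn: "\<And>n. holder \<beta> K (f n)" and f: "f' \<in> borel_measurable borel"
    and \<beta>: "0 < \<beta>" and m: "integrable \<nu> (\<lambda>z. tnorm z powr \<beta>)"
    and lim: "\<And>y. (\<lambda>n. f n (x n + y) - f n (x n)) \<longlonglongrightarrow> f' y"
  shows "(\<lambda>n. jump_op \<nu> (f n) (x n)) \<longlonglongrightarrow> (LINT y|\<nu>. f' y)"
  unfolding jump_op_def
proof (rule integral_dominated_convergence[where w = "\<lambda>y. K * tnorm y powr \<beta>"])
  show "AE y in \<nu>. norm (f n (x n + y) - f n (x n)) \<le> K * tnorm y powr \<beta>" for n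
    using holderD[OF fn, of n "x n + _" "x n"] by auto
  show "(\<lambda>y. f n (x n + y) - f n (x n)) \<in> borel_measurable \<nu>" for n
    using holder_measurable[OF fn \<beta>, of n] by measurable
  show "f' \<in> borel_measurable \<nu>" using f by measurable
qed (use m lim in auto)

lemma jump_op_vanishes_at_infinity:
  assumes f: "holder \<beta> K f" "0 < \<beta>" and m: "integrable \<nu> (\<lambda>z. tnorm z powr \<beta>)"
    and lim: "(f \<longlongrightarrow> 0) at_infinity"
  shows "(jump_op \<nu> f \<longlongrightarrow> 0) at_infinity"
proof (rule ccontr)
  assume "\<not> (jump_op \<nu> f \<longlongrightarrow> 0) at_infinity"
  then obtain e where e: "0 < e" "\<not> (\<forall>\<^sub>F x in at_infinity. \<bar>jump_op \<nu> f x\<bar> < e)"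
    by (auto simp: tendsto_iff)
  then have "\<exists>x. real n \<le> norm x \<and> e \<le> \<bar>jump_op \<nu> f x\<bar>" for n :: nat
    by (force simp: eventually_at_infinity not_less)
  then obtain x where x: "\<And>n. real n \<le> norm (x n)" "\<And>n. e \<le> \<bar>jump_op \<nu> f (x n)\<bar>"
    by metis
  have "filterlim (\<lambda>n. norm (x n + y)) at_top sequentially" for y
  proof (rule filterlim_at_top_mono)
    show "filterlim (\<lambda>n. - norm y + real n) at_top sequentially"
      by (rule filterlim_tendsto_add_at_top[OF tendsto_const filterlim_real_sequentially])
    show "\<forall>\<^sub>F n in sequentially. - norm y + real n \<le> norm (x n + y)"
    proof (intro always_eventually allI)
      fix n
      show "- norm y + real n \<le> norm (x n + y)"
        using x(1)[of n] norm_triangle_ineq4[of "x n + y" y] by simp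
    qed
  qed
  then have to0: "(\<lambda>n. f (x n + y)) \<longlonglongrightarrow> 0" for y
    using lim by (intro filterlim_compose[OF lim]) (simp add: filterlim_at_infinity_conv_norm_at_top)
  have "(\<lambda>n. jump_op \<nu> f (x n)) \<longlonglongrightarrow> (LINT y|\<nu>. 0)"
    by (rule jump_op_tendsto[OF f(1) _ f(2) m]) (use tendsto_diff[OF to0 to0[of 0]] in auto)
  then have "\<forall>\<^sub>F n in sequentially. \<bar>jump_op \<nu> f (x n)\<bar> < e"
    using e(1) by (simp add: tendsto_iff)
  then show False
    using x(2) by (auto simp: eventually_sequentially not_less[symmetric])
qed

section \<open>Moments under the scaling condition\<close>

text \<open>Since \<open>min 1 a\<^sup>2 \<le> a\<close> for \<open>a \<ge> 0\<close>, the quadratic integrand of the concentration function is dominated by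
the linear one of the integrability hypothesis.\<close>

lemma integrable_conc_integrand:
  assumes r: "0 < r"
  shows "integrable \<nu> (\<lambda>x. min 1 ((norm x)\<^sup>2 / r\<^sup>2))"
proof (rule Bochner_Integration.integrable_bound[OF integrable_mult_right[OF integrable_tnorm, of "max 1 (1 / r)"]])
  have "min 1 ((norm x)\<^sup>2 / r\<^sup>2) \<le> max 1 (1 / r) * tnorm x" for x :: "real^'d"
  proof (cases "norm x \<ge> 1")
    case True
    then show ?thesis by (simp add: tnorm_def)
  next
    case False
    define a where "a = norm x / r"
    have a: "0 \<le> a" using r by (simp add: a_def)
    have "min 1 ((norm x)\<^sup>2 / r\<^sup>2) = min 1 (a\<^sup>2)"
      by (simp add: a_def power_divide)
    also have "\<dots> \<le> a"
    proof (cases "a \<le> 1")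
      case True
      then have "a * a \<le> a * 1" using a by (intro mult_left_mono) auto
      then show ?thesis by (simp add: power2_eq_square min_le_iff_disj)
    qed simp
    also have "a = 1 / r * tnorm x"
      using False by (simp add: a_def tnorm_def)
    also have "\<dots> \<le> max 1 (1 / r) * tnorm x"
      by (intro mult_right_mono) auto
    finally show ?thesis .
  qed
  then show "AE x in \<nu>. norm (min 1 ((norm x)\<^sup>2 / r\<^sup>2)) \<le> norm (max 1 (1 / r) * tnorm x)"
    by (intro AE_I2) (auto intro: order_trans[OF _ abs_ge_self])
qed measurable

lemma emeasure_tail_le_conc_fun:
  assumes r: "0 < r"
  shows "emeasure \<nu> {z. r \<le> norm z} \<le> ennreal (conc_fun \<nu> r)"
proof -
  have "emeasure \<nu> {z. r \<le> norm z} = (\<integral>\<^sup>+z. indicator {z. r \<le> norm z} z \<partial>\<nu>)"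
    by (rule nn_integral_indicator[symmetric]) measurable
  also have "\<dots> \<le> (\<integral>\<^sup>+z. ennreal (min 1 ((norm z)\<^sup>2 / r\<^sup>2)) \<partial>\<nu>)"
    using r by (intro nn_integral_mono) (auto simp: indicator_def power_mono)
  also have "\<dots> = ennreal (conc_fun \<nu> r)"
    unfolding conc_fun_def by (rule nn_integral_eq_integral[OF integrable_conc_integrand[OF r]]) auto
  finally show ?thesis .
qed

text \<open>At scale \<open>l = 2\<^sup>-\<^sup>n\<close> the exponent \<open>\<alpha> = 1 / (n + 2)\<close> keeps \<open>l powr - \<alpha>\<close> below 2 while \<open>1 / \<alpha>\<close> is linear in
\<open>n\<close>, so that the concentration function at \<open>2\<^sup>-\<^sup>n\<close> is \<open>O(n)\<close>. With \<open>q = 2 powr - \<beta>\<close>, the moment is then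
compared with \<open>(1 - q) * (\<Sum>n. (n + 1) * q\<^sup>n)\<close>, which is \<open>1 / (1 - q)\<close> and hence of the order \<open>1 / \<beta>\<close>. The
factor \<open>1 - q\<close> comes from writing a power of the norm as a sum of its dyadic differences; estimating
it on dyadic shells instead would only give \<open>1 / \<beta>\<^sup>2\<close>, too weak for the convergence of the series.\<close>

lemma tnorm_powr_moments_from_scaling:
  assumes "\<exists>C>0. \<forall>\<alpha> l r. 0 < \<alpha> \<and> \<alpha> < 1 \<and> 0 < l \<and> l \<le> 1 \<and> 0 < r \<and> r < 1 \<longrightarrow>
          conc_fun \<nu> (l * r) \<le> C * inverse \<alpha> * l powr (- \<alpha>) * conc_fun \<nu> r"
  obtains D where "0 < D"
    "\<And>\<beta>. 0 < \<beta> \<Longrightarrow> \<beta> \<le> 1 \<Longrightarrow> integrable \<nu> (\<lambda>z. tnorm z powr \<beta>) \<and> (LINT z|\<nu>. tnorm z powr \<beta>) \<le> D / \<beta>"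
proof -
  obtain C where C: "0 < C" and sc: "\<And>\<alpha> l r. 0 < \<alpha> \<Longrightarrow> \<alpha> < 1 \<Longrightarrow> 0 < l \<Longrightarrow> l \<le> 1 \<Longrightarrow> 0 < r \<Longrightarrow> r < 1 \<Longrightarrow>
          conc_fun \<nu> (l * r) \<le> C * inverse \<alpha> * l powr (- \<alpha>) * conc_fun \<nu> r"
    using assms by auto
  \<comment> \<open>The constant collects \<open>1 / \<alpha> = n + 2 \<le> 2 * (n + 1)\<close> and \<open>l powr - \<alpha> \<le> 2\<close>.\<close>
  define E where "E = 4 * C * conc_fun \<nu> (1/2)"
  have cnn: "0 \<le> conc_fun \<nu> r" for r
    unfolding conc_fun_def by (rule Bochner_Integration.integral_nonneg) auto
  have E: "0 \<le> E"
    using C cnn by (simp add: E_def)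
  have h: "conc_fun \<nu> ((1/2) ^ Suc n) \<le> E * real (Suc n)" for n
  proof -
    define \<alpha> where "\<alpha> = 1 / real (n + 2)"
    have "conc_fun \<nu> ((1/2) ^ n * (1/2)) \<le> C * inverse \<alpha> * ((1/2) ^ n) powr (- \<alpha>) * conc_fun \<nu> (1/2)"
      by (rule sc) (auto simp: \<alpha>_def power_le_one)
    also have "\<dots> \<le> C * (2 * real (Suc n)) * 2 * conc_fun \<nu> (1/2)"
    proof (intro mult_right_mono mult_mono cnn)
      show "inverse \<alpha> \<le> 2 * real (Suc n)"
        by (simp add: \<alpha>_def)
      have "((1/2) ^ n) powr (- \<alpha>) = 2 powr (real n * \<alpha>)"
        by (simp add: powr_realpow[symmetric] powr_powr powr_minus_divide powr_divide)
      also have "\<dots> \<le> 2 powr 1"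
        by (rule powr_mono) (auto simp: \<alpha>_def)
      finally show "((1/2) ^ n) powr (- \<alpha>) \<le> 2" by simp
    qed (use C in \<open>auto simp: \<alpha>_def\<close>)
    finally show ?thesis
      by (simp add: E_def algebra_simps)
  qed
  have main: "(\<integral>\<^sup>+z. ennreal (tnorm z powr \<beta>) \<partial>\<nu>) \<le> ennreal ((4 * E + 1) / \<beta>)" if \<beta>: "0 < \<beta>" "\<beta> \<le> 1" for \<beta>
  proof -
    define q where "q = (1/2::real) powr \<beta>"
    have q0: "0 < q" by (simp add: q_def)
    have q_le: "\<beta> / 4 \<le> 1 - q"
    proof -
      have "\<beta> / 2 \<le> \<beta> * ln 2"
        using \<beta> ln2_ge_two_thirds by (simp add: field_simps)
      then have "1 + \<beta> / 2 \<le> exp (\<beta> * ln 2)"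
        using exp_ge_add_one_self[of "\<beta> * ln 2"] by linarith
      also have "exp (\<beta> * ln 2) = inverse q"
        by (simp add: q_def powr_def ln_div exp_minus[symmetric])
      finally have "q * (1 + \<beta> / 2) \<le> 1"
        using q0 by (simp add: field_simps)
      moreover have "1 \<le> (1 - \<beta> / 4) * (1 + \<beta> / 2)"
        using \<beta> by (simp add: algebra_simps power2_eq_square[symmetric]) (simp add: power2_eq_square mult_left_le)
      ultimately have "q * (1 + \<beta> / 2) \<le> (1 - \<beta> / 4) * (1 + \<beta> / 2)"
        by linarith
      then show ?thesis
        using \<beta> by (simp add: mult_le_cancel_right)
    qed
    then have q1: "q < 1" using \<beta> by auto
    define A where "A n = {z::real^'d. (1/2) ^ Suc n \<le> norm z}" for n
    have [measurable]: "A n \<in> sets borel" for n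
      unfolding A_def by measurable
    have pt: "ennreal (tnorm z powr \<beta>) \<le> (\<Sum>n. ennreal ((1 - q) * q ^ n * indicator (A n) z))" if z: "z \<noteq> 0" for z
    proof -
      have ex: "\<exists>n. z \<in> A n"
      proof -
        obtain n where "(1/2) ^ n < norm z"
          using z real_arch_pow_inv[of "norm z" "1/2"] by auto
        moreover have "(1/2::real) ^ Suc n \<le> (1/2) ^ n"
          by (rule power_decreasing) auto
        ultimately have "(1/2) ^ Suc n \<le> norm z" by linarith
        then show ?thesis unfolding A_def by blast
      qed
      \<comment> \<open>With \<open>N\<close> the dyadic scale of \<open>z\<close>, the series is the geometric tail from \<open>N\<close> on, which sums to \<open>q\<^sup>N\<close>.\<close>
      define N where "N = (LEAST n. z \<in> A n)"
      have N: "z \<in> A N" unfolding N_def using ex by (rule LeastI_ex)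
      have less: "z \<notin> A n" if "n < N" for n
        using that not_less_Least unfolding N_def by blast
      have ge: "z \<in> A (n + N)" for n
      proof -
        have "(1/2::real) ^ Suc (n + N) \<le> (1/2) ^ Suc N"
          by (rule power_decreasing) auto
        then show ?thesis using N unfolding A_def mem_Collect_eq by (rule order_trans)
      qed
      have "tnorm z \<le> (1/2) ^ N"
      proof (cases N)
        case (Suc k)
        then show ?thesis
          using less[of k] tnorm_le_norm[of z] by (auto simp: A_def simp del: power_Suc)
      qed simp
      then have "tnorm z powr \<beta> \<le> ((1/2) ^ N) powr \<beta>"
        using \<beta> by (intro powr_mono2) auto
      also have "\<dots> = q ^ N"
        by (simp add: q_def powr_realpow[symmetric] powr_powr mult.commute)
      finally have le: "tnorm z powr \<beta> \<le> q ^ N" .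
      have "(\<lambda>n. (1 - q) * q ^ N * q ^ n) sums ((1 - q) * q ^ N * (1 / (1 - q)))"
        using q0 q1 by (intro sums_mult geometric_sums) auto
      then have "(\<lambda>n. (1 - q) * q ^ (n + N) * indicator (A (n + N)) z) sums q ^ N"
        using q1 ge by (simp add: power_add mult_ac)
      then have "(\<lambda>n. (1 - q) * q ^ n * indicator (A n) z) sums
          (q ^ N + (\<Sum>n<N. (1 - q) * q ^ n * indicator (A n) z))"
        using sums_iff_shift[of "\<lambda>n. (1 - q) * q ^ n * indicator (A n) z" N "q ^ N"] by blast
      then have "(\<lambda>n. (1 - q) * q ^ n * indicator (A n) z) sums (q ^ N)"
        using less by simp
      then have "(\<Sum>n. ennreal ((1 - q) * q ^ n * indicator (A n) z)) = ennreal (q ^ N)"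
        using q0 q1 by (intro suminf_ennreal_eq) auto
      then show ?thesis
        using le by (simp add: ennreal_leI)
    qed
    have "(\<integral>\<^sup>+z. ennreal (tnorm z powr \<beta>) \<partial>\<nu>) \<le> (\<integral>\<^sup>+z. (\<Sum>n. ennreal ((1 - q) * q ^ n * indicator (A n) z)) \<partial>\<nu>)"
    proof (rule nn_integral_mono_AE)
      have "AE z in \<nu>. z \<noteq> 0"
        by (rule AE_I[where N = "{0}"]) (use nu_zero in auto)
      then show "AE z in \<nu>. ennreal (tnorm z powr \<beta>) \<le> (\<Sum>n. ennreal ((1 - q) * q ^ n * indicator (A n) z))"
        by eventually_elim (rule pt)
    qed
    also have "\<dots> = (\<Sum>n. \<integral>\<^sup>+z. ennreal ((1 - q) * q ^ n * indicator (A n) z) \<partial>\<nu>)"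
      by (rule nn_integral_suminf) measurable
    also have "\<dots> \<le> (\<Sum>n. ennreal ((1 - q) * E * (real (Suc n) * q ^ n)))"
    proof (rule suminf_le)
      fix n
      have "(\<integral>\<^sup>+z. ennreal ((1 - q) * q ^ n * indicator (A n) z) \<partial>\<nu>) =
          (\<integral>\<^sup>+z. ennreal ((1 - q) * q ^ n) * indicator (A n) z \<partial>\<nu>)"
        by (rule nn_integral_cong) (auto simp: indicator_def)
      also have "\<dots> = ennreal ((1 - q) * q ^ n) * emeasure \<nu> (A n)"
        by (rule nn_integral_cmult_indicator) measurable
      also have "emeasure \<nu> (A n) \<le> ennreal (conc_fun \<nu> ((1/2) ^ Suc n))"
        unfolding A_def by (rule emeasure_tail_le_conc_fun) simp
      also have "\<dots> \<le> ennreal (E * real (Suc n))"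
        using h by (rule ennreal_leI)
      also have "ennreal ((1 - q) * q ^ n) * ennreal (E * real (Suc n)) = ennreal ((1 - q) * E * (real (Suc n) * q ^ n))"
        using q0 q1 E by (subst ennreal_mult[symmetric]) (auto simp: mult_ac)
      finally show "(\<integral>\<^sup>+z. ennreal ((1 - q) * q ^ n * indicator (A n) z) \<partial>\<nu>) \<le> ennreal ((1 - q) * E * (real (Suc n) * q ^ n))"
        by (auto simp: mult_left_mono)
    qed auto
    also have "\<dots> = ennreal ((1 - q) * E * (1 / (1 - q)\<^sup>2))"
      using q0 q1 E by (intro suminf_ennreal_eq sums_mult geometric_deriv_sums) auto
    also have "(1 - q) * E * (1 / (1 - q)\<^sup>2) = E / (1 - q)"
      using q1 by (simp add: power2_eq_square)
    also have "ennreal (E / (1 - q)) \<le> ennreal ((4 * E + 1) / \<beta>)"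
    proof (rule ennreal_leI)
      have "E / (1 - q) \<le> E / (\<beta> / 4)"
        using q_le \<beta> E q1 by (intro divide_left_mono) auto
      also have "\<dots> \<le> (4 * E + 1) / \<beta>"
        using \<beta> by (simp add: field_simps)
      finally show "E / (1 - q) \<le> (4 * E + 1) / \<beta>" .
    qed
    finally show ?thesis .
  qed
  show thesis
  proof (rule that[of "4 * E + 1"])
    fix \<beta> :: real assume \<beta>: "0 < \<beta>" "\<beta> \<le> 1"
    have int: "integrable \<nu> (\<lambda>z. tnorm z powr \<beta>)"
      by (rule integrableI_bounded) (use main[OF \<beta>] in \<open>auto simp: less_top[symmetric] top_unique\<close>)
    have "ennreal (LINT z|\<nu>. tnorm z powr \<beta>) = (\<integral>\<^sup>+z. ennreal (tnorm z powr \<beta>) \<partial>\<nu>)"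
      by (rule nn_integral_eq_integral[symmetric, OF int]) auto
    also note main[OF \<beta>]
    finally have "(LINT z|\<nu>. tnorm z powr \<beta>) \<le> (4 * E + 1) / \<beta>"
      using E \<beta> by (subst (asm) ennreal_le_iff) auto
    with int show "integrable \<nu> (\<lambda>z. tnorm z powr \<beta>) \<and> (LINT z|\<nu>. tnorm z powr \<beta>) \<le> (4 * E + 1) / \<beta>" ..
  qed (use E in auto)
qed

end

section \<open>Gaussian kernels and their Fourier representation\<close>

definition gauss_kernel :: "'a::euclidean_space \<Rightarrow> real" where
  "gauss_kernel x = exp (- (norm x)\<^sup>2 / 2)"

text \<open>A product over the coordinates, which makes its characteristic function factorise.\<close>

definition std_gaussian :: "'a::euclidean_space measure" where
  "std_gaussian = distr (\<Pi>\<^sub>M b\<in>Basis. std_normal_distribution) borel (\<lambda>f. \<Sum>b\<in>Basis. f b *\<^sub>R b)"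

lemma gauss_kernel_eq_prod: "gauss_kernel x = (\<Prod>b\<in>Basis. exp (- (x \<bullet> b)\<^sup>2 / 2))"
proof -
  have "(norm x)\<^sup>2 = (\<Sum>b\<in>Basis. (x \<bullet> b)\<^sup>2)"
    unfolding power2_norm_eq_inner by (subst euclidean_inner) (simp add: power2_eq_square)
  then show ?thesis
    by (simp add: gauss_kernel_def exp_sum[symmetric] sum_negf sum_divide_distrib)
qed

lemma gauss_kernel_pos: "0 < gauss_kernel x" and gauss_kernel_le_1: "gauss_kernel x \<le> 1"
  and gauss_kernel_0: "gauss_kernel 0 = 1"
  by (simp_all add: gauss_kernel_def)

lemma continuous_gauss_kernel: "continuous_on UNIV gauss_kernel"
  unfolding gauss_kernel_def by (intro continuous_intros) auto

lemma borel_measurable_gauss_kernel [measurable]: "gauss_kernel \<in> borel_measurable borel"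
  using continuous_gauss_kernel by (rule borel_measurable_continuous_onI)

lemma integrable_gauss_kernel: "integrable lborel gauss_kernel"
proof (rule integrableI_bounded)
  have one: "(\<integral>\<^sup>+x. ennreal (exp (- x\<^sup>2 / 2)) \<partial>lborel) < \<infinity>"
  proof -
    have "integrable lborel (\<lambda>x::real. sqrt (2 * pi) * (std_normal_density x * x ^ 0))"
      by (intro integrable_mult_right integrable_std_normal_moment)
    then have "integrable lborel (\<lambda>x::real. exp (- x\<^sup>2 / 2))"
      by (simp add: std_normal_density_def)
    then show ?thesis
      by (auto simp: integrable_iff_bounded)
  qed
  have "(\<integral>\<^sup>+x. ennreal (norm (gauss_kernel x)) \<partial>(lborel :: 'a measure)) =
      (\<integral>\<^sup>+x. (\<Prod>b\<in>Basis. ennreal (exp (- (x \<bullet> b)\<^sup>2 / 2))) \<partial>(lborel :: 'a measure))"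
    by (simp add: gauss_kernel_eq_prod prod_ennreal prod_nonneg abs_prod)
  also have "\<dots> = (\<Prod>b\<in>(Basis :: 'a set). \<integral>\<^sup>+x. ennreal (exp (- x\<^sup>2 / 2)) \<partial>lborel)"
    by (rule nn_integral_lborel_prod) auto
  also have "\<dots> < \<infinity>"
    using one by (simp add: power_less_top_ennreal)
  finally show "(\<integral>\<^sup>+x. ennreal (norm (gauss_kernel (x::'a))) \<partial>lborel) < \<infinity>" .
qed simp

lemma prob_space_std_normal: "prob_space std_normal_distribution"
  using real_dist_normal_dist by (simp add: real_distribution_def)

lemma measurable_sum_Basis [measurable]:
  "(\<lambda>f. \<Sum>b\<in>Basis. f b *\<^sub>R b) \<in> (\<Pi>\<^sub>M b\<in>Basis. std_normal_distribution) \<rightarrow>\<^sub>M (borel :: 'a::euclidean_space measure)"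
  by measurable

lemma prob_space_std_gaussian: "prob_space std_gaussian"
proof -
  interpret prob_space "\<Pi>\<^sub>M b\<in>(Basis::'a set). std_normal_distribution"
    by (intro prob_space_PiM prob_space_std_normal)
  show "prob_space (std_gaussian :: 'a measure)"
    unfolding std_gaussian_def by (rule prob_space_distr) measurable
qed

lemma sets_std_gaussian [measurable_cong, simp]: "sets std_gaussian = sets borel"
  by (simp add: std_gaussian_def)

lemma integrable_norm_std_gaussian: "integrable (std_gaussian :: 'a::euclidean_space measure) norm"
proof -
  let ?P = "\<Pi>\<^sub>M b\<in>(Basis::'a set). std_normal_distribution"
  have comp: "integrable ?P (\<lambda>f. \<bar>f b\<bar>)" if b: "b \<in> Basis" for b
  proof -
    have "integrable std_normal_distribution (\<lambda>x. \<bar>x\<bar>)"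
      using integrable_abs[OF integrable_std_normal_distribution_moment[of 1]] by simp
    then have "integrable (distr ?P std_normal_distribution (\<lambda>f. f b)) (\<lambda>x. \<bar>x\<bar>)"
      by (subst distr_PiM_component) (auto simp: b prob_space_std_normal)
    from integrable_distr[OF _ this] show ?thesis
      using b by (simp add: measurable_component_singleton)
  qed
  have "integrable ?P (\<lambda>f. norm (\<Sum>b\<in>Basis. f b *\<^sub>R b))"
  proof (rule Bochner_Integration.integrable_bound)
    show "integrable ?P (\<lambda>f. \<Sum>b\<in>Basis. \<bar>f b\<bar>)"
      by (intro Bochner_Integration.integrable_sum comp)
    have "norm (\<Sum>b\<in>(Basis::'a set). f b *\<^sub>R b) \<le> (\<Sum>b\<in>(Basis::'a set). \<bar>f b\<bar>)" for f
      by (rule order_trans[OF norm_sum]) simp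
    then show "AE f in ?P. norm (norm (\<Sum>b\<in>(Basis::'a set). f b *\<^sub>R b)) \<le> norm (\<Sum>b\<in>(Basis::'a set). \<bar>f b\<bar>)"
      by (auto intro: order_trans[OF _ abs_ge_self])
  qed measurable
  then show ?thesis
    unfolding std_gaussian_def by (subst integrable_distr_eq) auto
qed

lemma char_std_gaussian:
  fixes x :: "'a::euclidean_space"
  shows "(LINT \<xi>|std_gaussian. iexp (\<xi> \<bullet> x)) = complex_of_real (gauss_kernel x)"
proof -
  let ?P = "\<Pi>\<^sub>M b\<in>(Basis::'a set). std_normal_distribution"
  interpret product_sigma_finite "\<lambda>_::'a. std_normal_distribution"
    using prob_space_std_normal by (simp add: product_sigma_finite_def prob_space_imp_sigma_finite)
  have "(LINT \<xi>|std_gaussian. iexp (\<xi> \<bullet> x)) = (LINT f|?P. iexp ((\<Sum>b\<in>Basis. f b *\<^sub>R b) \<bullet> x))"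
    unfolding std_gaussian_def by (subst integral_distr) auto
  also have "\<dots> = (LINT f|?P. (\<Prod>b\<in>Basis. iexp ((x \<bullet> b) * f b)))"
  proof (rule Bochner_Integration.integral_cong[OF refl])
    fix f :: "'a \<Rightarrow> real"
    have "(\<Sum>b\<in>Basis. f b *\<^sub>R b) \<bullet> x = (\<Sum>b\<in>Basis. (x \<bullet> b) * f b)"
      by (subst inner_commute) (simp add: inner_sum_right mult.commute)
    then show "iexp ((\<Sum>b\<in>Basis. f b *\<^sub>R b) \<bullet> x) = (\<Prod>b\<in>Basis. iexp ((x \<bullet> b) * f b))"
      by (simp only: of_real_sum sum_distrib_left exp_sum finite_Basis)
  qed
  also have "\<dots> = (\<Prod>b\<in>Basis. LINT y|std_normal_distribution. iexp ((x \<bullet> b) * y))"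
  proof (rule product_integral_prod)
    show "integrable std_normal_distribution (\<lambda>y. iexp ((x \<bullet> b) * y))" for b
      by (rule prob_space.integrable_iexp[OF prob_space_std_normal]) auto
  qed simp
  also have "\<dots> = (\<Prod>b\<in>Basis. char std_normal_distribution (x \<bullet> b))"
    by (simp add: char_def)
  also have "\<dots> = complex_of_real (gauss_kernel x)"
    by (simp add: char_std_normal_distribution gauss_kernel_eq_prod)
  finally show ?thesis .
qed

lemma iexp_diff_le: "cmod (iexp a - iexp b) \<le> \<bar>a - b\<bar>"
proof -
  have "iexp a - iexp b = iexp b * (iexp (a - b) - 1)"
    by (simp add: algebra_simps flip: exp_add)
  then show ?thesis
    using iexp_approx1[of "a - b" 0] by (simp add: norm_mult)
qed

text \<open>Splits the increment of a character into a frequency weight and the truncated norm, the two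
weights needed for the exchange of integrals and for the linear bound on the Levy exponent.\<close>

lemma one_minus_iexp_le: "cmod (1 - iexp (\<xi> \<bullet> z)) \<le> 2 * (1 + norm \<xi>) * tnorm (z::'a::real_inner)"
proof (cases "norm z \<ge> 1")
  case True
  have "cmod (1 - iexp (\<xi> \<bullet> z)) \<le> 2"
    by (rule order_trans[OF norm_triangle_ineq4]) simp
  also have "\<dots> \<le> 2 * (1 + norm \<xi>) * tnorm z"
    using True by (simp add: tnorm_def)
  finally show ?thesis .
next
  case False
  have "cmod (1 - iexp (\<xi> \<bullet> z)) \<le> \<bar>\<xi> \<bullet> z\<bar>"
    using iexp_diff_le[of 0 "\<xi> \<bullet> z"] by simp
  also have "\<dots> \<le> norm \<xi> * norm z"
    by (rule Cauchy_Schwarz_ineq2)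
  also have "\<dots> \<le> 2 * (1 + norm \<xi>) * norm z"
    by (intro mult_right_mono) auto
  finally show ?thesis
    using False by (simp add: tnorm_def)
qed

text \<open>The kernel is an average of characters, and the Gaussian measure has a first moment.\<close>

lemma gauss_kernel_lipschitz:
  obtains L where "0 \<le> L" "\<And>x y :: 'a::euclidean_space. \<bar>gauss_kernel x - gauss_kernel y\<bar> \<le> L * tnorm (x - y)"
proof -
  interpret G: prob_space "std_gaussian :: 'a measure" by (rule prob_space_std_gaussian)
  define m where "m = (LINT \<xi>|(std_gaussian :: 'a measure). norm \<xi>)"
  have int: "integrable (std_gaussian :: 'a measure) (\<lambda>\<xi>. iexp (\<xi> \<bullet> x))" for x
    by (rule G.integrable_iexp) auto
  have le: "\<bar>gauss_kernel x - gauss_kernel y\<bar> \<le> m * norm (x - y)" for x y :: 'a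
  proof -
    have "\<bar>gauss_kernel x - gauss_kernel y\<bar> = cmod (complex_of_real (gauss_kernel x) - complex_of_real (gauss_kernel y))"
      by (metis norm_of_real of_real_diff)
    also have "\<dots> = cmod (LINT \<xi>|(std_gaussian :: 'a measure). iexp (\<xi> \<bullet> x) - iexp (\<xi> \<bullet> y))"
      using int by (simp add: char_std_gaussian)
    also have "\<dots> \<le> (LINT \<xi>|(std_gaussian :: 'a measure). cmod (iexp (\<xi> \<bullet> x) - iexp (\<xi> \<bullet> y)))"
      by (rule integral_norm_bound)
    also have "\<dots> \<le> (LINT \<xi>|(std_gaussian :: 'a measure). norm \<xi> * norm (x - y))"
    proof (rule integral_mono)
      show "cmod (iexp (\<xi> \<bullet> x) - iexp (\<xi> \<bullet> y)) \<le> norm \<xi> * norm (x - y)" for \<xi> :: 'a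
        using iexp_diff_le[of "\<xi> \<bullet> x" "\<xi> \<bullet> y"] Cauchy_Schwarz_ineq2[of \<xi> "x - y"]
        by (simp add: inner_diff_right)
    qed (use int integrable_norm_std_gaussian in auto)
    finally show ?thesis by (simp add: m_def)
  qed
  show thesis
  proof (rule that[of "max 1 m"])
    fix x y :: 'a
    have "\<bar>gauss_kernel x - gauss_kernel y\<bar> \<le> 1"
      using gauss_kernel_pos[of x] gauss_kernel_pos[of y] gauss_kernel_le_1[of x] gauss_kernel_le_1[of y]
      by linarith
    then show "\<bar>gauss_kernel x - gauss_kernel y\<bar> \<le> max 1 m * tnorm (x - y)"
      using le[of x y] mult_right_mono[of m "max 1 m" "norm (x - y)"]
      by (auto simp: tnorm_def min_def)
  qed simp
qed

text \<open>A Gaussian convolution is a superposition of characters: represent the kernel by its characteristic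
function and exchange the integrals. The weight \<open>w\<close> is, up to normalisation, the Fourier transform
of \<open>F\<close>. The finite first moment of \<open>\<gamma>\<close> is what will absorb the linear growth of the Levy exponent.\<close>

lemma gauss_convolution_superposition:
  fixes F :: "'a::euclidean_space \<Rightarrow> real"
  assumes F: "integrable lborel F" and c: "0 < c"
  obtains \<gamma> :: "'a measure" and w B
  where "finite_measure \<gamma>" "sets \<gamma> = sets borel" "integrable \<gamma> norm"
    "w \<in> borel_measurable borel" "\<And>\<xi>. cmod (w \<xi>) \<le> B"
    "\<And>x. complex_of_real (LINT z|lborel. gauss_kernel z * F (x - z /\<^sub>R c)) = (LINT \<xi>|\<gamma>. w \<xi> * iexp (\<xi> \<bullet> x))"
proof -
  note [measurable] = borel_measurable_integrable[OF F]
  interpret G: prob_space "std_gaussian :: 'a measure" by (rule prob_space_std_gaussian)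
  define \<gamma> :: "'a measure" where "\<gamma> = distr std_gaussian borel (\<lambda>\<xi>. c *\<^sub>R \<xi>)"
  have sets_\<gamma>[measurable_cong]: "sets \<gamma> = sets borel" by (simp add: \<gamma>_def)
  interpret \<gamma>: prob_space \<gamma>
    unfolding \<gamma>_def by (rule G.prob_space_distr) measurable
  have char: "(LINT \<xi>|\<gamma>. iexp (\<xi> \<bullet> x)) = complex_of_real (gauss_kernel (c *\<^sub>R x))" for x
    unfolding \<gamma>_def by (subst integral_distr) (auto simp: char_std_gaussian[symmetric])
  define w where "w \<xi> = c ^ DIM('a) * (LINT v|lborel. F v * iexp (- (\<xi> \<bullet> v)))" for \<xi>
  show thesis
  proof (rule that[of \<gamma> w "c ^ DIM('a) * (LINT v|lborel. \<bar>F v\<bar>)"])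
    show "finite_measure \<gamma>" by unfold_locales
    show "sets \<gamma> = sets borel" by (rule sets_\<gamma>)
    show "integrable \<gamma> norm"
      unfolding \<gamma>_def using integrable_norm_std_gaussian by (subst integrable_distr_eq) auto
    show "w \<in> borel_measurable borel"
      unfolding w_def by measurable
    show "cmod (w \<xi>) \<le> c ^ DIM('a) * (LINT v|lborel. \<bar>F v\<bar>)" for \<xi>
    proof -
      have "cmod (LINT v|lborel. F v * iexp (- (\<xi> \<bullet> v))) \<le> (LINT v|lborel. cmod (F v * iexp (- (\<xi> \<bullet> v))))"
        by (rule integral_norm_bound)
      also have "\<dots> = (LINT v|lborel. \<bar>F v\<bar>)"
        by (simp add: norm_mult flip: of_real_minus)
      finally show ?thesis
        using c by (simp add: w_def norm_mult norm_power)
    qed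
    fix x
    \<comment> \<open>Substitution \<open>z = c (x - v)\<close>.\<close>
    have "(LINT z|lborel. gauss_kernel z * F (x - z /\<^sub>R c)) =
        (LINT z|density (distr lborel borel (\<lambda>v. c *\<^sub>R x + (- c) *\<^sub>R v)) (\<lambda>_. ennreal (\<bar>- c\<bar> ^ DIM('a))). gauss_kernel z * F (x - z /\<^sub>R c))"
      using lborel_affine[of "- c" "c *\<^sub>R x"] c by (simp add: ennreal_power)
    also have "\<dots> = c ^ DIM('a) * (LINT z|distr lborel borel (\<lambda>v. c *\<^sub>R x + (- c) *\<^sub>R v). gauss_kernel z * F (x - z /\<^sub>R c))"
      using c by (subst integral_density) auto
    also have "(LINT z|distr lborel borel (\<lambda>v. c *\<^sub>R x + (- c) *\<^sub>R v). gauss_kernel z * F (x - z /\<^sub>R c)) =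
        (LINT v|lborel. gauss_kernel (c *\<^sub>R (x - v)) * F v)"
      using c by (subst integral_distr) (auto simp: algebra_simps)
    finally have eq: "(LINT z|lborel. gauss_kernel z * F (x - z /\<^sub>R c)) =
        c ^ DIM('a) * (LINT v|lborel. gauss_kernel (c *\<^sub>R (x - v)) * F v)" .
    have "complex_of_real (LINT z|lborel. gauss_kernel z * F (x - z /\<^sub>R c)) =
        c ^ DIM('a) * (LINT v|lborel. complex_of_real (gauss_kernel (c *\<^sub>R (x - v)) * F v))"
      unfolding eq integral_complex_of_real by simp
    also have "(LINT v|lborel. complex_of_real (gauss_kernel (c *\<^sub>R (x - v)) * F v)) =
        (LINT v|lborel. LINT \<xi>|\<gamma>. F v * iexp (- (\<xi> \<bullet> v)) * iexp (\<xi> \<bullet> x))"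
    proof (rule Bochner_Integration.integral_cong[OF refl])
      fix v
      have eq: "F v * iexp (- (\<xi> \<bullet> v)) * iexp (\<xi> \<bullet> x) = F v * iexp (\<xi> \<bullet> (x - v))" for \<xi>
        by (simp add: mult.assoc inner_diff_right algebra_simps flip: exp_add)
      show "complex_of_real (gauss_kernel (c *\<^sub>R (x - v)) * F v) =
          (LINT \<xi>|\<gamma>. F v * iexp (- (\<xi> \<bullet> v)) * iexp (\<xi> \<bullet> x))"
        unfolding eq by (simp only: char integral_mult_right_zero of_real_mult mult.commute)
    qed
    also have "\<dots> = (LINT \<xi>|\<gamma>. LINT v|lborel. F v * iexp (- (\<xi> \<bullet> v)) * iexp (\<xi> \<bullet> x))"
    proof (rule fubini_swap_dominated(1)[where a = "\<lambda>_. 1" and b = "\<lambda>v. \<bar>F v\<bar>"])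
      show "sigma_finite_measure \<gamma>" by unfold_locales
      show "sigma_finite_measure lborel" by (rule sigma_finite_lborel)
      show "cmod (F v * iexp (- (\<xi> \<bullet> v)) * iexp (\<xi> \<bullet> x)) \<le> 1 * \<bar>F v\<bar>" for \<xi> v
        by (simp add: norm_mult flip: of_real_minus)
    qed (use F in \<open>auto\<close>)
    also have "c ^ DIM('a) * \<dots> = (LINT \<xi>|\<gamma>. w \<xi> * iexp (\<xi> \<bullet> x))"
      unfolding w_def integral_mult_left_zero by (simp only: mult.assoc integral_mult_right_zero)
    finally show "complex_of_real (LINT z|lborel. gauss_kernel z * F (x - z /\<^sub>R c)) = (LINT \<xi>|\<gamma>. w \<xi> * iexp (\<xi> \<bullet> x))" .
  qed
qed

section \<open>Dynkin's formula\<close>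

locale levy_semigroup = levy_measure \<nu> for \<nu> :: "(real^'d) measure" +
  fixes p :: "real \<Rightarrow> (real^'d) measure"
  assumes prob_p: "\<And>t. 0 \<le> t \<Longrightarrow> prob_space (p t)"
    and sets_p: "\<And>t. 0 \<le> t \<Longrightarrow> sets (p t) = sets borel"
    and p_fourier: "\<And>t \<xi>. 0 \<le> t \<Longrightarrow>
          (LINT x|p t. iexp (\<xi> \<bullet> x)) = exp (- (complex_of_real t * levy_exponent \<nu> \<xi>))"
begin

lemma integrable_one_minus_iexp: "integrable \<nu> (\<lambda>z. 1 - iexp (\<xi> \<bullet> z))"
  by (rule Bochner_Integration.integrable_bound[OF integrable_mult_right[OF integrable_tnorm, of "2 * (1 + norm \<xi>)"]])
    (use one_minus_iexp_le[of \<xi>] in \<open>auto intro: order_trans[OF _ abs_ge_self]\<close>)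

lemma levy_exponent_bound: "cmod (levy_exponent \<nu> \<xi>) \<le> 2 * (1 + norm \<xi>) * (LINT z|\<nu>. tnorm z)"
proof -
  have "cmod (levy_exponent \<nu> \<xi>) \<le> (LINT z|\<nu>. cmod (1 - iexp (\<xi> \<bullet> z)))"
    unfolding levy_exponent_def by (rule integral_norm_bound)
  also have "\<dots> \<le> (LINT z|\<nu>. 2 * (1 + norm \<xi>) * tnorm z)"
    by (rule integral_mono) (use integrable_one_minus_iexp integrable_tnorm one_minus_iexp_le in auto)
  finally show ?thesis by simp
qed

lemma Re_levy_exponent_nonneg: "0 \<le> Re (levy_exponent \<nu> \<xi>)"
proof -
  have "Re (levy_exponent \<nu> \<xi>) = (LINT z|\<nu>. Re (1 - iexp (\<xi> \<bullet> z)))"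
    unfolding levy_exponent_def using integrable_one_minus_iexp by (rule integral_Re[symmetric])
  also have "\<dots> \<ge> 0"
    by (rule Bochner_Integration.integral_nonneg) (simp add: Re_exp)
  finally show ?thesis .
qed

lemma cmod_exp_levy_exponent_le_1:
  "0 \<le> t \<Longrightarrow> cmod (exp (- (complex_of_real t * levy_exponent \<nu> \<xi>))) \<le> 1"
  using Re_levy_exponent_nonneg[of \<xi>] by simp

lemma borel_measurable_levy_exponent [measurable]: "levy_exponent \<nu> \<in> borel_measurable borel"
proof -
  interpret sigma_finite_measure \<nu> by (rule sigma_finite_nu)
  show ?thesis
    unfolding levy_exponent_def[abs_def] by measurable
qed

lemma borel_measurable_jump_op:
  fixes f :: "real^'d \<Rightarrow> 'b::{banach, second_countable_topology}"
  assumes [measurable]: "f \<in> borel_measurable borel"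
  shows "jump_op \<nu> f \<in> borel_measurable borel"
proof -
  interpret sigma_finite_measure \<nu> by (rule sigma_finite_nu)
  show ?thesis
    unfolding jump_op_def[abs_def] by measurable
qed

text \<open>On the character of frequency \<open>\<xi>\<close> the jump operator is multiplication by \<open>- \<psi> \<xi>\<close> and the semigroup is
multiplication by \<open>exp (- t \<psi> \<xi>)\<close>, so the formula is the fundamental theorem of calculus for the
exponential. It survives integration against \<open>w\<close> because \<open>\<psi>\<close> grows at most linearly.\<close>

lemma dynkin_superposition:
  assumes \<gamma>: "finite_measure \<gamma>" "sets \<gamma> = sets borel" "integrable \<gamma> norm"
    and w [measurable]: "w \<in> borel_measurable borel" and B: "\<And>\<xi>. cmod (w \<xi>) \<le> B"
    and f: "\<And>x. f x = (LINT \<xi>|\<gamma>. w \<xi> * iexp (\<xi> \<bullet> x))"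
    and t: "0 \<le> t"
  shows "((\<lambda>s. LINT y|p s. jump_op \<nu> f (x + y)) has_integral ((LINT y|p t. f (x + y)) - f x)) {0..t}"
proof -
  interpret \<gamma>: finite_measure \<gamma> by (rule \<gamma>(1))
  note [measurable_cong] = \<gamma>(2)
  let ?\<psi> = "levy_exponent \<nu>"
  define c where "c = (LINT z|\<nu>. tnorm z)"
  have c: "0 \<le> c" unfolding c_def by (rule Bochner_Integration.integral_nonneg) auto
  have B0: "0 \<le> B" using B[of 0] norm_ge_zero order_trans by blast
  have int1: "integrable \<gamma> (\<lambda>\<xi>. 1 + norm \<xi>)"
    using \<gamma>(3) by auto
  have intw: "integrable \<gamma> (\<lambda>\<xi>. w \<xi> * iexp (\<xi> \<bullet> u))" for u
    by (rule \<gamma>.integrable_const_bound[of _ B]) (use B in \<open>auto simp: norm_mult\<close>)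
  have jump: "jump_op \<nu> f u = (LINT \<xi>|\<gamma>. - ?\<psi> \<xi> * w \<xi> * iexp (\<xi> \<bullet> u))" for u
  proof -
    have "f (u + z) - f u = (LINT \<xi>|\<gamma>. - w \<xi> * iexp (\<xi> \<bullet> u) * (1 - iexp (\<xi> \<bullet> z)))" for z
    proof -
      have "f (u + z) - f u = (LINT \<xi>|\<gamma>. w \<xi> * iexp (\<xi> \<bullet> (u + z)) - w \<xi> * iexp (\<xi> \<bullet> u))"
        unfolding f using intw[of "u + z"] intw[of u] by simp
      also have "\<dots> = (LINT \<xi>|\<gamma>. - w \<xi> * iexp (\<xi> \<bullet> u) * (1 - iexp (\<xi> \<bullet> z)))"
        by (rule Bochner_Integration.integral_cong) (auto simp: inner_add_right algebra_simps exp_add)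
      finally show ?thesis .
    qed
    then have "jump_op \<nu> f u = (LINT z|\<nu>. LINT \<xi>|\<gamma>. - w \<xi> * iexp (\<xi> \<bullet> u) * (1 - iexp (\<xi> \<bullet> z)))"
      by (simp add: jump_op_def)
    also have "\<dots> = (LINT \<xi>|\<gamma>. LINT z|\<nu>. - w \<xi> * iexp (\<xi> \<bullet> u) * (1 - iexp (\<xi> \<bullet> z)))"
    proof (rule fubini_swap_dominated(1)[where a = "\<lambda>\<xi>. 2 * B * (1 + norm \<xi>)" and b = tnorm])
      show "integrable \<gamma> (\<lambda>\<xi>. 2 * B * (1 + norm \<xi>))"
        by (rule integrable_mult_right[OF int1])
      show "sigma_finite_measure \<gamma>" by unfold_locales
      show "cmod (- w \<xi> * iexp (\<xi> \<bullet> u) * (1 - iexp (\<xi> \<bullet> z))) \<le> 2 * B * (1 + norm \<xi>) * tnorm z" for \<xi> z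
        using mult_mono[OF B[of \<xi>] one_minus_iexp_le[of \<xi> z] B0] by (simp add: norm_mult mult_ac)
    qed (use integrable_tnorm sigma_finite_nu in auto)
    also have "\<dots> = (LINT \<xi>|\<gamma>. - ?\<psi> \<xi> * w \<xi> * iexp (\<xi> \<bullet> u))"
      by (rule Bochner_Integration.integral_cong) (auto simp: levy_exponent_def integral_mult_right_zero)
    finally show ?thesis .
  qed
  have semi: "(LINT y|p s. LINT \<xi>|\<gamma>. v \<xi> * iexp (\<xi> \<bullet> (x + y))) =
      (LINT \<xi>|\<gamma>. v \<xi> * iexp (\<xi> \<bullet> x) * exp (- (s * ?\<psi> \<xi>)))"
    if s: "0 \<le> s" and v: "integrable \<gamma> v" for s and v :: "real^'d \<Rightarrow> complex"
  proof -
    interpret ps: prob_space "p s" using s by (rule prob_p)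
    note [measurable_cong] = sets_p[OF s]
    note [measurable] = borel_measurable_integrable[OF v]
    have "(LINT y|p s. LINT \<xi>|\<gamma>. v \<xi> * iexp (\<xi> \<bullet> (x + y))) = (LINT \<xi>|\<gamma>. LINT y|p s. v \<xi> * iexp (\<xi> \<bullet> (x + y)))"
    proof (rule fubini_swap_dominated(1)[where a = "\<lambda>\<xi>. cmod (v \<xi>)" and b = "\<lambda>_. 1"])
      show "sigma_finite_measure \<gamma>" "sigma_finite_measure (p s)" by unfold_locales
    qed (use v in \<open>auto simp: norm_mult\<close>)
    also have "\<dots> = (LINT \<xi>|\<gamma>. v \<xi> * iexp (\<xi> \<bullet> x) * exp (- (s * ?\<psi> \<xi>)))"
    proof (rule Bochner_Integration.integral_cong[OF refl])
      fix \<xi>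
      have "v \<xi> * iexp (\<xi> \<bullet> (x + y)) = v \<xi> * iexp (\<xi> \<bullet> x) * iexp (\<xi> \<bullet> y)" for y
        by (simp add: inner_add_right algebra_simps exp_add)
      then show "(LINT y|p s. v \<xi> * iexp (\<xi> \<bullet> (x + y))) = v \<xi> * iexp (\<xi> \<bullet> x) * exp (- (s * ?\<psi> \<xi>))"
        by (simp only: integral_mult_right_zero p_fourier[OF s])
    qed
    finally show ?thesis .
  qed
  \<comment> \<open>The integrand in time and frequency; it is dominated by \<open>1 + norm \<xi>\<close> because \<open>Re \<psi> \<ge> 0\<close>.\<close>
  define J where "J s \<xi> = - ?\<psi> \<xi> * w \<xi> * iexp (\<xi> \<bullet> x) * exp (- (complex_of_real s * ?\<psi> \<xi>))" for s \<xi>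
  have wb: "integrable \<gamma> w"
    by (rule \<gamma>.integrable_const_bound[of _ B]) (use B in auto)
  have \<psi>w_le: "cmod (- ?\<psi> \<xi> * w \<xi>) \<le> 2 * c * B * (1 + norm \<xi>)" for \<xi>
    using mult_mono[OF levy_exponent_bound[of \<xi>] B[of \<xi>]] B0 c by (simp add: norm_mult c_def mult_ac)
  have \<psi>w: "integrable \<gamma> (\<lambda>\<xi>. - ?\<psi> \<xi> * w \<xi>)"
    by (rule Bochner_Integration.integrable_bound[OF integrable_mult_right[OF int1, of "2 * c * B"]])
      (use \<psi>w_le in \<open>auto intro: order_trans[OF _ abs_ge_self]\<close>)
  have ftc: "(LINT s|lborel. indicator {0..t} s *\<^sub>R J s \<xi>) = w \<xi> * iexp (\<xi> \<bullet> x) * exp (- (t * ?\<psi> \<xi>)) - w \<xi> * iexp (\<xi> \<bullet> x)" for \<xi>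
  proof -
    let ?F = "\<lambda>s. w \<xi> * iexp (\<xi> \<bullet> x) * exp (- (complex_of_real s * ?\<psi> \<xi>))"
    have "has_bochner_integral lborel (\<lambda>s. indicator {0..t} s *\<^sub>R J s \<xi>) (?F t - ?F 0)"
    proof (rule has_bochner_integral_FTC_Icc[OF t])
      fix s
      have "((\<lambda>z. w \<xi> * iexp (\<xi> \<bullet> x) * exp (- (z * ?\<psi> \<xi>))) has_field_derivative J s \<xi>) (at (complex_of_real s))"
        unfolding J_def by (auto intro!: derivative_eq_intros)
      then show "(?F has_vector_derivative J s \<xi>) (at s within {0..t})"
        using has_vector_derivative_real_field has_vector_derivative_at_within by blast
    next
      show "continuous_on {0..t} (\<lambda>s. J s \<xi>)"
        unfolding J_def by (intro continuous_intros)
    qed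
    from has_bochner_integral_integral_eq[OF this] show ?thesis by simp
  qed
  have Jm: "(\<lambda>(s, \<xi>). indicator {0..t} s *\<^sub>R J s \<xi>) \<in> borel_measurable (lborel \<Otimes>\<^sub>M \<gamma>)"
    unfolding J_def by measurable
  have ind: "integrable lborel (indicator {0..t} :: real \<Rightarrow> real)"
    using t by (intro integrable_real_indicator) auto
  have dom: "integrable \<gamma> (\<lambda>\<xi>. 2 * c * B * (1 + norm \<xi>))"
    by (rule integrable_mult_right[OF int1])
  have Jle: "norm (indicator {0..t} s *\<^sub>R J s \<xi>) \<le> indicator {0..t} s * (2 * c * B * (1 + norm \<xi>))" for s \<xi>
  proof (cases "s \<in> {0..t}")
    case True
    have "cmod (J s \<xi>) = cmod (- ?\<psi> \<xi> * w \<xi>) * cmod (exp (- (complex_of_real s * ?\<psi> \<xi>)))"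
      by (simp add: J_def norm_mult)
    also have "\<dots> \<le> (2 * c * B * (1 + norm \<xi>)) * 1"
      by (rule mult_mono[OF \<psi>w_le cmod_exp_levy_exponent_le_1]) (use True B0 c in auto)
    finally show ?thesis using True by simp
  qed simp
  have sf: "sigma_finite_measure \<gamma>" by unfold_locales
  note swap = fubini_swap_dominated[OF sigma_finite_lborel sf Jm ind dom Jle]
  have eq: "(LINT y|p s. jump_op \<nu> f (x + y)) = (LINT \<xi>|\<gamma>. J s \<xi>)" if "0 \<le> s" for s
    unfolding jump using semi[OF that \<psi>w] by (simp add: J_def)
  have fin: "(LINT y|p t. f (x + y)) - f x = (LINT s|lborel. LINT \<xi>|\<gamma>. indicator {0..t} s *\<^sub>R J s \<xi>)"
  proof -
    have "(LINT y|p t. f (x + y)) - f x =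
        (LINT \<xi>|\<gamma>. w \<xi> * iexp (\<xi> \<bullet> x) * exp (- (t * ?\<psi> \<xi>))) - (LINT \<xi>|\<gamma>. w \<xi> * iexp (\<xi> \<bullet> x))"
      using semi[OF t wb] by (simp add: f)
    also have "\<dots> = (LINT \<xi>|\<gamma>. w \<xi> * iexp (\<xi> \<bullet> x) * exp (- (t * ?\<psi> \<xi>)) - w \<xi> * iexp (\<xi> \<bullet> x))"
    proof (rule Bochner_Integration.integral_diff[symmetric])
      have "cmod (w \<xi> * iexp (\<xi> \<bullet> x) * exp (- (t * ?\<psi> \<xi>))) \<le> B" for \<xi>
        using mult_mono[OF B[of \<xi>] cmod_exp_levy_exponent_le_1[OF t, of \<xi>]] B0 by (simp add: norm_mult)
      then show "integrable \<gamma> (\<lambda>\<xi>. w \<xi> * iexp (\<xi> \<bullet> x) * exp (- (t * ?\<psi> \<xi>)))"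
        by (intro \<gamma>.integrable_const_bound[of _ B]) auto
    qed (rule intw)
    also have "\<dots> = (LINT \<xi>|\<gamma>. LINT s|lborel. indicator {0..t} s *\<^sub>R J s \<xi>)"
      by (simp only: ftc)
    also have "\<dots> = (LINT s|lborel. LINT \<xi>|\<gamma>. indicator {0..t} s *\<^sub>R J s \<xi>)"
      by (rule swap(1))
    finally show ?thesis .
  qed
  have si: "set_integrable lborel {0..t} (\<lambda>s. LINT \<xi>|\<gamma>. J s \<xi>)"
    unfolding set_integrable_def using swap(3) by simp
  have "((\<lambda>s. LINT \<xi>|\<gamma>. J s \<xi>) has_integral ((LINT y|p t. f (x + y)) - f x)) {0..t}"
    using set_borel_integral_eq_integral[OF si] fin
    by (simp add: has_integral_iff set_lebesgue_integral_def)
  then show ?thesis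
    by (rule has_integral_eq[rotated]) (simp add: eq)
qed

text \<open>The integrated form of \<open>d/dt P t f = P t (A f)\<close>, which is stable under bounded pointwise limits.\<close>

definition dynkin :: "(real^'d \<Rightarrow> real) \<Rightarrow> bool" where
  "dynkin f \<longleftrightarrow> (\<forall>t\<ge>0. \<forall>x.
    ((\<lambda>s. semigroup_op p s (jump_op \<nu> f) x) has_integral (semigroup_op p t f x - f x)) {0..t})"

lemma dynkin_real_superposition:
  assumes \<gamma>: "finite_measure \<gamma>" "sets \<gamma> = sets borel" "integrable \<gamma> norm"
    and w: "w \<in> borel_measurable borel" "\<And>\<xi>. cmod (w \<xi>) \<le> B"
    and f: "\<And>x. complex_of_real (f x) = (LINT \<xi>|\<gamma>. w \<xi> * iexp (\<xi> \<bullet> x))"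
  shows "dynkin f"
  unfolding dynkin_def
proof (intro allI impI)
  fix t :: real and x assume t: "0 \<le> t"
  have jump: "jump_op \<nu> (\<lambda>x. complex_of_real (f x)) u = complex_of_real (jump_op \<nu> f u)" for u
    unfolding jump_op_def of_real_diff[symmetric] integral_complex_of_real ..
  from has_integral_linear[OF dynkin_superposition[OF \<gamma> w f t, of x] bounded_linear_Re]
  show "((\<lambda>s. semigroup_op p s (jump_op \<nu> f) x) has_integral (semigroup_op p t f x - f x)) {0..t}"
    unfolding jump integral_complex_of_real semigroup_op_def by (simp add: o_def)
qed

lemma
  assumes s: "0 \<le> s" and u: "u \<in> borel_measurable borel" and le: "\<And>x. \<bar>u x\<bar> \<le> c"
  shows integrable_semigroup: "integrable (p s) (\<lambda>y. u (x + y))"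
    and semigroup_op_bound: "\<bar>semigroup_op p s u x\<bar> \<le> c"
proof -
  interpret ps: prob_space "p s" using s by (rule prob_p)
  note [measurable_cong] = sets_p[OF s] and [measurable] = u
  show int: "integrable (p s) (\<lambda>y. u (x + y))"
    by (rule ps.integrable_const_bound[of _ c]) (use le in auto)
  have "\<bar>semigroup_op p s u x\<bar> \<le> (LINT y|p s. \<bar>u (x + y)\<bar>)"
    unfolding semigroup_op_def by (rule integral_abs_bound)
  also have "\<dots> \<le> (LINT y|p s. c)"
    by (rule integral_mono) (use int le in auto)
  finally show "\<bar>semigroup_op p s u x\<bar> \<le> c"
    by (simp add: ps.prob_space)
qed

lemma semigroup_op_tendsto:
  assumes s: "0 \<le> s" and u: "\<And>n. u n \<in> borel_measurable borel" and le: "\<And>n x. \<bar>u n x\<bar> \<le> c"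
    and v: "v \<in> borel_measurable borel" and lim: "\<And>x. (\<lambda>n. u n x) \<longlonglongrightarrow> v x"
  shows "(\<lambda>n. semigroup_op p s (u n) x) \<longlonglongrightarrow> semigroup_op p s v x"
proof -
  interpret ps: prob_space "p s" using s by (rule prob_p)
  note [measurable_cong] = sets_p[OF s] and [measurable] = u v
  show ?thesis
    unfolding semigroup_op_def
    by (rule integral_dominated_convergence[where w = "\<lambda>_. c"]) (use le lim in auto)
qed

lemma dynkin_limit:
  assumes fn: "\<And>n. holder \<beta> K (f n)" and g: "holder \<beta> K g"
    and \<beta>: "0 < \<beta>" and m: "integrable \<nu> (\<lambda>z. tnorm z powr \<beta>)"
    and le: "\<And>n x. \<bar>f n x\<bar> \<le> M" and lim: "\<And>x. (\<lambda>n. f n x) \<longlonglongrightarrow> g x"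
    and dyn: "\<And>n. dynkin (f n)"
  shows "dynkin g"
  unfolding dynkin_def
proof (intro allI impI)
  fix t :: real and x assume t: "0 \<le> t"
  note fm = holder_measurable[OF fn \<beta>] and gm = holder_measurable[OF g \<beta>]
  have jl: "(\<lambda>n. jump_op \<nu> (f n) y) \<longlonglongrightarrow> jump_op \<nu> g y" for y
    unfolding jump_op_def[of \<nu> g]
    by (rule jump_op_tendsto[OF fn _ \<beta> m]) (use gm lim in \<open>auto intro: tendsto_diff\<close>)
  let ?c = "K * (LINT z|\<nu>. tnorm z powr \<beta>)"
  show "((\<lambda>s. semigroup_op p s (jump_op \<nu> g) x) has_integral (semigroup_op p t g x - g x)) {0..t}"
  proof (rule has_integral_dominated_convergence)
    show "((\<lambda>s. semigroup_op p s (jump_op \<nu> (f n)) x) has_integral (semigroup_op p t (f n) x - f n x)) {0..t}" for n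
      using dyn[of n] t by (simp add: dynkin_def)
    show "(\<lambda>_. ?c) integrable_on {0..t}"
      by (rule integrable_const_ivl)
    show "\<forall>s\<in>{0..t}. norm (semigroup_op p s (jump_op \<nu> (f n)) x) \<le> ?c" for n
      using semigroup_op_bound[OF _ borel_measurable_jump_op[OF fm] jump_op_bound[OF fn \<beta> m]] by simp
    show "\<forall>s\<in>{0..t}. (\<lambda>n. semigroup_op p s (jump_op \<nu> (f n)) x) \<longlonglongrightarrow> semigroup_op p s (jump_op \<nu> g) x"
      using semigroup_op_tendsto[OF _ borel_measurable_jump_op[OF fm] jump_op_bound[OF fn \<beta> m]
          borel_measurable_jump_op[OF gm] jl] by simp
    show "(\<lambda>n. semigroup_op p t (f n) x - f n x) \<longlonglongrightarrow> semigroup_op p t g x - g x"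
      by (intro tendsto_diff lim semigroup_op_tendsto[OF t fm le gm lim])
  qed
qed

text \<open>The function is damped by a wide Gaussian, which makes it integrable, and then averaged against a
narrow one, which makes it a superposition of characters. Damping adds \<open>M * L\<close> to the Hoelder
constant and averaging does not increase it, so the approximations are uniformly Hoelder and
converge pointwise.\<close>

theorem dynkin_holder:
  assumes f: "holder \<beta> K f" and \<beta>: "0 < \<beta>" "\<beta> \<le> 1"
    and le: "\<And>x. \<bar>f x\<bar> \<le> M" and m: "integrable \<nu> (\<lambda>z. tnorm z powr \<beta>)"
  shows "dynkin f"
proof -
  let ?G = "gauss_kernel :: real^'d \<Rightarrow> real"
  note [measurable] = holder_measurable[OF f \<beta>(1)]
  define Z where "Z = (LINT z|lborel. ?G z)"
  have Z: "0 < Z"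
  proof -
    have "0 \<le> Z"
      unfolding Z_def by (rule Bochner_Integration.integral_nonneg) (simp add: gauss_kernel_pos less_imp_le)
    moreover have "Z \<noteq> 0"
    proof
      assume "Z = 0"
      then have "AE z in lborel. ?G z = 0"
        unfolding Z_def using integrable_gauss_kernel
        by (subst (asm) integral_nonneg_eq_0_iff_AE) (auto simp: gauss_kernel_pos less_imp_le)
      then have "AE z in (lborel :: (real^'d) measure). False"
        by eventually_elim (use gauss_kernel_pos less_irrefl in metis)
      then have "emeasure lborel (UNIV :: (real^'d) set) = 0"
        by (simp add: AE_iff_measurable[of UNIV])
      then show False by simp
    qed
    ultimately show ?thesis by simp
  qed
  obtain L where L: "0 \<le> L" "\<And>x y. \<bar>?G x - ?G y\<bar> \<le> L * tnorm (x - y)"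
    by (rule gauss_kernel_lipschitz) blast
  have M: "0 \<le> M" using le[of 0] by linarith
  \<comment> \<open>The same scale \<open>c n\<close> widens the damping Gaussian and narrows the averaging one.\<close>
  define c where "c n = real n + 1" for n
  have c: "0 < c n" "1 \<le> c n" for n by (auto simp: c_def)
  define F where "F n y = f y * ?G (y /\<^sub>R c n) / Z" for n y
  have [measurable]: "F n \<in> borel_measurable borel" for n
    unfolding F_def by measurable
  have F_le: "\<bar>F n y\<bar> \<le> M / Z" for n y
  proof -
    have "\<bar>f y\<bar> * \<bar>?G (y /\<^sub>R c n)\<bar> \<le> M * 1"
      using gauss_kernel_pos[of "y /\<^sub>R c n"] gauss_kernel_le_1[of "y /\<^sub>R c n"] le[of y] M
      by (intro mult_mono) auto
    then show ?thesis using Z by (simp add: F_def abs_mult divide_right_mono)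
  qed
  define K' where "K' = K + M * L"
  have F_holder: "\<bar>F n y - F n y'\<bar> \<le> K' / Z * tnorm (y - y') powr \<beta>" for n y y'
  proof -
    have tnorm_le: "tnorm ((y - y') /\<^sub>R c n) \<le> tnorm (y - y') powr \<beta>"
    proof (cases "y = y'")
      case False
      have "norm (y - y') / c n \<le> norm (y - y') / 1"
        by (rule divide_left_mono) (use c[of n] in auto)
      then have "tnorm ((y - y') /\<^sub>R c n) \<le> tnorm (y - y')"
        using c[of n] by (auto simp: tnorm_def divide_inverse mult.commute)
      also have "\<dots> = tnorm (y - y') powr 1"
        using False by simp
      also have "\<dots> \<le> tnorm (y - y') powr \<beta>"
        using False \<beta> by (intro powr_mono') auto
      finally show ?thesis .
    qed simp
    have "f y * ?G (y /\<^sub>R c n) - f y' * ?G (y' /\<^sub>R c n) =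
        (f y - f y') * ?G (y /\<^sub>R c n) + f y' * (?G (y /\<^sub>R c n) - ?G (y' /\<^sub>R c n))"
      by (simp add: algebra_simps)
    also have "\<bar>\<dots>\<bar> \<le> \<bar>f y - f y'\<bar> * \<bar>?G (y /\<^sub>R c n)\<bar> + \<bar>f y'\<bar> * \<bar>?G (y /\<^sub>R c n) - ?G (y' /\<^sub>R c n)\<bar>"
      by (simp add: abs_mult[symmetric])
    also have "\<dots> \<le> K * tnorm (y - y') powr \<beta> * 1 + M * (L * tnorm (y - y') powr \<beta>)"
    proof (intro add_mono mult_mono)
      have "\<bar>?G (y /\<^sub>R c n) - ?G (y' /\<^sub>R c n)\<bar> \<le> L * tnorm ((y - y') /\<^sub>R c n)"
        using L(2)[of "y /\<^sub>R c n" "y' /\<^sub>R c n"] by (simp add: scaleR_right_diff_distrib)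
      also have "\<dots> \<le> L * tnorm (y - y') powr \<beta>"
        using L(1) tnorm_le by (intro mult_left_mono)
      finally show "\<bar>?G (y /\<^sub>R c n) - ?G (y' /\<^sub>R c n)\<bar> \<le> L * tnorm (y - y') powr \<beta>" .
      show "\<bar>f y - f y'\<bar> \<le> K * tnorm (y - y') powr \<beta>" by (rule holderD[OF f])
      then show "0 \<le> K * tnorm (y - y') powr \<beta>" by linarith
    qed (use le M gauss_kernel_pos[of "y /\<^sub>R c n"] gauss_kernel_le_1[of "y /\<^sub>R c n"] in auto)
    finally have "\<bar>f y * ?G (y /\<^sub>R c n) - f y' * ?G (y' /\<^sub>R c n)\<bar> / Z \<le> (K' * tnorm (y - y') powr \<beta>) / Z"
      using Z by (intro divide_right_mono) (auto simp: K'_def algebra_simps)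
    then show ?thesis
      using Z by (simp add: F_def diff_divide_distrib[symmetric])
  qed
  have G_int: "integrable lborel ?G" by (rule integrable_gauss_kernel)
  have GF_le: "\<bar>?G z * F n u\<bar> \<le> ?G z * (M / Z)" for z u n
    using mult_left_mono[OF F_le[of n u], of "?G z"] gauss_kernel_pos[of z] by (simp add: abs_mult)
  have GF_int: "integrable lborel (\<lambda>z. ?G z * F n (x - z /\<^sub>R c n))" for n x
  proof (rule Bochner_Integration.integrable_bound[OF integrable_mult_left[OF G_int, of "M / Z"]])
    show "AE z in lborel. norm (?G z * F n (x - z /\<^sub>R c n)) \<le> norm (?G z * (M / Z))"
      unfolding real_norm_def by (intro AE_I2 order_trans[OF GF_le abs_ge_self])
  qed measurable
  have F_int: "integrable lborel (F n)" for n
  proof -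
    have "integrable (density (distr lborel borel (\<lambda>x::real^'d. 0 + c n *\<^sub>R x)) (\<lambda>_. ennreal (\<bar>c n\<bar> ^ DIM(real^'d)))) (\<lambda>y. ?G (y /\<^sub>R c n))"
      using c[of n] G_int by (subst integrable_density) (auto simp: integrable_distr_eq)
    then have "integrable lborel (\<lambda>y. ?G (y /\<^sub>R c n))"
      using lborel_affine[of "c n" "0 :: real^'d"] c[of n] by (simp add: ennreal_power)
    then have "integrable lborel (\<lambda>y. M / Z * ?G (y /\<^sub>R c n))"
      by (rule integrable_mult_right)
    then show ?thesis
    proof (rule Bochner_Integration.integrable_bound)
      have "norm (F n y) \<le> norm (M / Z * ?G (y /\<^sub>R c n))" for y
      proof -
        have "\<bar>f y\<bar> * ?G (y /\<^sub>R c n) / Z \<le> M * ?G (y /\<^sub>R c n) / Z"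
          using le[of y] Z gauss_kernel_pos[of "y /\<^sub>R c n"] by (intro divide_right_mono mult_right_mono) auto
        then show ?thesis
          using Z M gauss_kernel_pos[of "y /\<^sub>R c n"] by (simp add: F_def abs_mult)
      qed
      then show "AE y in lborel. norm (F n y) \<le> norm (M / Z * ?G (y /\<^sub>R c n))" by simp
    qed measurable
  qed
  define g where "g n x = (LINT z|lborel. ?G z * F n (x - z /\<^sub>R c n))" for n x
  have g_bound: "\<bar>g n x\<bar> \<le> M" for n x
  proof -
    have "\<bar>g n x\<bar> \<le> (LINT z|lborel. \<bar>?G z * F n (x - z /\<^sub>R c n)\<bar>)"
      unfolding g_def by (rule integral_abs_bound)
    also have "\<dots> \<le> (LINT z|lborel. ?G z * (M / Z))"
      by (rule integral_mono) (use GF_int G_int GF_le in auto)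
    also have "\<dots> = M"
      using Z by (simp add: Z_def[symmetric])
    finally show ?thesis .
  qed
  have g_holder: "holder \<beta> K' (g n)" for n
    unfolding holder_def
  proof (intro allI)
    fix x y
    have "\<bar>g n x - g n y\<bar> = \<bar>LINT z|lborel. ?G z * F n (x - z /\<^sub>R c n) - ?G z * F n (y - z /\<^sub>R c n)\<bar>"
      unfolding g_def using GF_int by (subst Bochner_Integration.integral_diff) auto
    also have "\<dots> \<le> (LINT z|lborel. \<bar>?G z * F n (x - z /\<^sub>R c n) - ?G z * F n (y - z /\<^sub>R c n)\<bar>)"
      by (rule integral_abs_bound)
    also have "\<dots> \<le> (LINT z|lborel. ?G z * (K' / Z * tnorm (x - y) powr \<beta>))"
    proof (rule integral_mono)
      fix z
      show "\<bar>?G z * F n (x - z /\<^sub>R c n) - ?G z * F n (y - z /\<^sub>R c n)\<bar> \<le> ?G z * (K' / Z * tnorm (x - y) powr \<beta>)"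
        using mult_left_mono[OF F_holder[of n "x - z /\<^sub>R c n" "y - z /\<^sub>R c n"], of "?G z"] gauss_kernel_pos[of z]
        by (simp add: right_diff_distrib[symmetric] abs_mult)
    qed (use GF_int G_int in auto)
    also have "\<dots> = K' * tnorm (x - y) powr \<beta>"
      using Z by (simp add: Z_def[symmetric])
    finally show "\<bar>g n x - g n y\<bar> \<le> K' * tnorm (x - y) powr \<beta>" .
  qed
  have g_lim: "(\<lambda>n. g n x) \<longlonglongrightarrow> f x" for x
  proof -
    have inv: "(\<lambda>n. inverse (c n)) \<longlonglongrightarrow> 0"
      using LIMSEQ_inverse_real_of_nat by (simp add: c_def add.commute)
    have arg: "(\<lambda>n. x - z /\<^sub>R c n) \<longlonglongrightarrow> x" for z
      using tendsto_diff[OF tendsto_const tendsto_scaleR[OF inv tendsto_const], of x z] by simp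
    have f_lim: "(\<lambda>n. f (x - z /\<^sub>R c n)) \<longlonglongrightarrow> f x" for z
      by (rule continuous_on_tendsto_compose[OF holder_continuous[OF f \<beta>(1)] arg]) auto
    have G_lim: "(\<lambda>n. ?G ((x - z /\<^sub>R c n) /\<^sub>R c n)) \<longlonglongrightarrow> 1" for z
    proof -
      have "(\<lambda>n. (x - z /\<^sub>R c n) /\<^sub>R c n) \<longlonglongrightarrow> 0"
        using tendsto_scaleR[OF inv arg[of z]] by simp
      from continuous_on_tendsto_compose[OF continuous_gauss_kernel this] show ?thesis
        by (simp add: gauss_kernel_0)
    qed
    have "(\<lambda>n. g n x) \<longlonglongrightarrow> (LINT z|lborel. ?G z * (f x * 1 / Z))"
      unfolding g_def
    proof (rule integral_dominated_convergence[where w = "\<lambda>z. ?G z * (M / Z)"])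
      show "AE z in lborel. (\<lambda>n. ?G z * F n (x - z /\<^sub>R c n)) \<longlonglongrightarrow> ?G z * (f x * 1 / Z)"
        unfolding F_def using Z by (intro AE_I2 tendsto_intros f_lim G_lim) auto
      show "AE z in lborel. norm (?G z * F n (x - z /\<^sub>R c n)) \<le> ?G z * (M / Z)" for n
        using GF_le by simp
    qed (use G_int in auto)
    then show ?thesis
      using Z by (simp add: Z_def[symmetric])
  qed
  have g_dynkin: "dynkin (g n)" for n
  proof -
    obtain \<gamma> :: "(real^'d) measure" and w B where "finite_measure \<gamma>" "sets \<gamma> = sets borel" "integrable \<gamma> norm"
        "w \<in> borel_measurable borel" "\<And>\<xi>. cmod (w \<xi>) \<le> B"
        "\<And>x. complex_of_real (LINT z|lborel. ?G z * F n (x - z /\<^sub>R c n)) = (LINT \<xi>|\<gamma>. w \<xi> * iexp (\<xi> \<bullet> x))"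
      by (rule gauss_convolution_superposition[OF F_int[of n] c(1)[of n]]) blast
    then show ?thesis
      by (intro dynkin_real_superposition[of \<gamma> w B "g n"]) (auto simp: g_def)
  qed
  have f': "holder \<beta> K' f"
    unfolding holder_def
  proof (intro allI)
    fix x y :: "real^'d"
    have "K * tnorm (x - y) powr \<beta> \<le> K' * tnorm (x - y) powr \<beta>"
      using M L by (intro mult_right_mono) (auto simp: K'_def)
    then show "\<bar>f x - f y\<bar> \<le> K' * tnorm (x - y) powr \<beta>"
      using holderD[OF f, of x y] by linarith
  qed
  show ?thesis
    by (rule dynkin_limit[OF g_holder f' \<beta>(1) m g_bound g_lim g_dynkin])
qed

end

section \<open>Taylor expansion of the semigroup along iterates of the jump operator\<close>

lemma holder_mono_const:
  assumes "holder \<beta> K f" "K \<le> K'"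
  shows "holder \<beta> K' f"
  unfolding holder_def
  by (intro allI order_trans[OF holderD[OF assms(1)]] mult_right_mono[OF assms(2)]) simp

text \<open>A single term of the exponential series at \<open>n\<close>.\<close>

lemma nat_power_le_fact_exp: "real n ^ n \<le> fact n * exp (real n)"
proof -
  have "(\<lambda>k. real n ^ k /\<^sub>R fact k) sums exp (real n)"
    by (rule exp_converges)
  then have "(\<Sum>k\<in>{n}. real n ^ k /\<^sub>R fact k) \<le> exp (real n)"
    by (intro sum_le_suminf[of _ "{n}", THEN order_trans]) (auto simp: sums_iff)
  then have "real n ^ n / fact n \<le> exp (real n)"
    by (simp add: divide_inverse mult.commute)
  then show ?thesis
    by (simp add: pos_divide_le_eq mult.commute)
qed

lemma has_integral_power_over_fact:
  assumes "0 \<le> t"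
  shows "((\<lambda>s::real. s ^ j / fact j) has_integral (t ^ Suc j / fact (Suc j))) {0..t}"
proof -
  have "((\<lambda>s::real. s ^ j / fact j) has_integral (t ^ Suc j / fact (Suc j) - 0 ^ Suc j / fact (Suc j))) {0..t}"
  proof (rule fundamental_theorem_of_calculus[OF assms])
    fix s
    have "((\<lambda>s::real. s ^ Suc j / fact (Suc j)) has_field_derivative (real (Suc j) * s ^ j / fact (Suc j))) (at s within {0..t})"
      by (auto intro!: derivative_eq_intros simp del: power_Suc)
    also have "real (Suc j) * s ^ j / fact (Suc j) = s ^ j / fact j"
      by (simp del: of_nat_Suc)
    finally show "((\<lambda>s::real. s ^ Suc j / fact (Suc j)) has_vector_derivative (s ^ j / fact j)) (at s within {0..t})"
      by (simp add: has_real_derivative_iff_has_vector_derivative)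
  qed
  then show ?thesis by simp
qed

text \<open>The scaling condition enters the expansion through the moment bound \<open>D / \<beta>\<close>.\<close>

locale log_levy_semigroup = levy_semigroup \<nu> p for \<nu> :: "(real^'d) measure" and p +
  fixes D :: real
  assumes D_pos: "0 < D"
    and integrable_moment: "\<And>\<beta>. 0 < \<beta> \<Longrightarrow> \<beta> \<le> 1 \<Longrightarrow> integrable \<nu> (\<lambda>z. tnorm z powr \<beta>)"
    and moment_le: "\<And>\<beta>. 0 < \<beta> \<Longrightarrow> \<beta> \<le> 1 \<Longrightarrow> (LINT z|\<nu>. tnorm z powr \<beta>) \<le> D / \<beta>"
begin

context
  fixes g :: "real^'d \<Rightarrow> real" and K :: real
  assumes g_holder: "holder 1 K g" and K: "0 \<le> K" and g_C0: "g \<in> C0"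
begin

abbreviation iter where "iter k \<equiv> (jump_op \<nu> ^^ k) g"

text \<open>With \<open>n\<close> fixed in advance, each application of the jump operator spends \<open>1 / n\<close> of the exponent and
costs the factor \<open>2 * D * n\<close>.\<close>

lemma iterate_holder:
  assumes n: "0 < n" and k: "k \<le> n"
  shows "holder (1 - real k / real n) ((2 * D * real n) ^ k * K) (iter k)"
  using k
proof (induction k)
  case 0
  then show ?case using g_holder by simp
next
  case (Suc k)
  let ?\<epsilon> = "1 / real n"
  have \<epsilon>: "0 < ?\<epsilon>" "?\<epsilon> \<le> 1" "?\<epsilon> \<le> 1 - real k / real n"
    using n Suc.prems by (auto simp: field_simps)
  have K': "0 \<le> (2 * D * real n) ^ k * K"
    using K D_pos by simp
  have step: "holder (1 - real k / real n - ?\<epsilon>) (2 * ((2 * D * real n) ^ k * K) * (LINT z|\<nu>. tnorm z powr ?\<epsilon>)) (iter (Suc k))"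
    using jump_op_holder[OF Suc.IH K' \<epsilon>(1) \<epsilon>(3) integrable_moment[OF \<epsilon>(1,2)]] Suc.prems by simp
  have const: "2 * ((2 * D * real n) ^ k * K) * (LINT z|\<nu>. tnorm z powr ?\<epsilon>) \<le> (2 * D * real n) ^ Suc k * K"
  proof -
    have "2 * ((2 * D * real n) ^ k * K) * (LINT z|\<nu>. tnorm z powr ?\<epsilon>) \<le> 2 * ((2 * D * real n) ^ k * K) * (D / ?\<epsilon>)"
      using K' by (intro mult_left_mono moment_le \<epsilon>) auto
    then show ?thesis by (simp add: mult_ac)
  qed
  have "1 - real k / real n - ?\<epsilon> = 1 - real (Suc k) / real n"
    using n by (simp add: field_simps)
  then show ?case
    using holder_mono_const[OF step const] by (simp only:)
qed

lemma iterate_holder_pos: "holder (1 / real (Suc k)) ((2 * D * real (Suc k)) ^ k * K) (iter k)"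
proof -
  have "1 - real k / real (Suc k) = 1 / real (Suc k)"
    by (simp add: field_simps)
  then show ?thesis
    using iterate_holder[of "Suc k" k] by simp
qed

lemma exponent_range: "0 < 1 / real (Suc k)" "1 / real (Suc k) \<le> 1"
  by auto

lemmas iterate_measurable [measurable] = holder_measurable[OF iterate_holder_pos exponent_range(1)]

text \<open>After \<open>n - 1\<close> steps an exponent \<open>1 / n\<close> is left, just enough for the last step to be bounded.\<close>

lemma iterate_bound:
  assumes n: "0 < n"
  shows "\<bar>iter n x\<bar> \<le> (2 * D * real n) ^ n * K"
proof -
  obtain k where k: "n = Suc k" using n gr0_implies_Suc by blast
  have K': "0 \<le> (2 * D * real n) ^ k * K"
    using K D_pos by simp
  have "\<bar>iter n x\<bar> \<le> (2 * D * real n) ^ k * K * (LINT z|\<nu>. tnorm z powr (1 / real n))"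
    using jump_op_bound[OF iterate_holder_pos[of k] exponent_range(1) integrable_moment[OF exponent_range], of x] k by simp
  also have "\<dots> \<le> (2 * D * real n) ^ k * K * (D / (1 / real n))"
    using K' by (intro mult_left_mono moment_le) (auto simp: k)
  also have "\<dots> \<le> (2 * D * real n) ^ k * K * (2 * D * real n)"
    using K' D_pos by (intro mult_left_mono) auto
  finally show ?thesis
    by (simp add: k mult_ac)
qed

lemma iterate_C0: "iter k \<in> C0"
proof -
  have "(iter k \<longlongrightarrow> 0) at_infinity"
  proof (induction k)
    case 0
    then show ?case using g_C0 by (simp add: C0_def)
  next
    case (Suc k)
    then show ?case
      using jump_op_vanishes_at_infinity[OF iterate_holder_pos exponent_range(1) integrable_moment[OF exponent_range]] by simp
  qed
  then show ?thesis
    using holder_continuous[OF iterate_holder_pos exponent_range(1)] by (simp add: C0_def)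
qed

lemma iterate_bounded: "\<exists>M. \<forall>x. \<bar>iter k x\<bar> \<le> M"
proof (cases k)
  case 0
  have "\<bar>g x\<bar> \<le> \<bar>g 0\<bar> + K" for x
  proof -
    have "K * tnorm (x - 0) powr 1 \<le> K * 1"
      using K by (intro mult_left_mono) auto
    then show ?thesis
      using holderD[OF g_holder, of x 0] by linarith
  qed
  then show ?thesis using 0 by auto
next
  case (Suc m)
  then show ?thesis using iterate_bound[of k] by blast
qed

lemma iterate_dynkin: "dynkin (iter k)"
proof -
  obtain M where "\<And>x. \<bar>iter k x\<bar> \<le> M"
    using iterate_bounded by blast
  from dynkin_holder[OF iterate_holder_pos exponent_range this integrable_moment[OF exponent_range]]
  show ?thesis .
qed

lemma iterate_integral:
  assumes "0 \<le> t"
  shows "((\<lambda>s. semigroup_op p s (iter (Suc k)) x) has_integral (semigroup_op p t (iter k) x - iter k x)) {0..t}"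
  using iterate_dynkin[of k] assms by (simp add: dynkin_def)

text \<open>Dynkin's formula for the next iterate shows that it moves by at most \<open>c * s\<close> under \<open>P s\<close>; inserted in
Dynkin's formula for the present one, this bounds the error of the difference quotient by \<open>c * t\<close>,
uniformly in space.\<close>

lemma is_generator_value_iterate: "is_generator_value p (iter k) (iter (Suc k))"
proof -
  obtain c where c: "\<And>x. \<bar>iter (Suc (Suc k)) x\<bar> \<le> c"
    using iterate_bounded by blast
  have c0: "0 \<le> c" using c[of 0] by linarith
  have dev: "\<bar>semigroup_op p s (iter (Suc k)) x - iter (Suc k) x\<bar> \<le> c * s" if s: "0 \<le> s" for s x
  proof -
    have "norm (semigroup_op p s (iter (Suc k)) x - iter (Suc k) x) \<le> c * measure lborel {0..s}"
    proof (rule has_integral_bound_real[OF c0 _ iterate_integral[OF s]])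
      show "norm (semigroup_op p r (iter (Suc (Suc k))) x) \<le> c" if "r \<in> {0..s} - {}" for r
        using that semigroup_op_bound[OF _ iterate_measurable c] by auto
    qed simp
    then show ?thesis using s by simp
  qed
  have quot: "\<bar>(semigroup_op p t (iter k) x - iter k x) / t - iter (Suc k) x\<bar> \<le> c * t" if t: "0 < t" for t x
  proof -
    have "((\<lambda>s. semigroup_op p s (iter (Suc k)) x - iter (Suc k) x) has_integral
        (semigroup_op p t (iter k) x - iter k x - measure lborel {0..t} *\<^sub>R iter (Suc k) x)) {0..t}"
      using t by (intro has_integral_diff iterate_integral has_integral_const_real) auto
    then have "norm (semigroup_op p t (iter k) x - iter k x - measure lborel {0..t} *\<^sub>R iter (Suc k) x) \<le> (c * t) * measure lborel {0..t}"
    proof (rule has_integral_bound_real[rotated 2])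
      show "norm (semigroup_op p s (iter (Suc k)) x - iter (Suc k) x) \<le> c * t" if "s \<in> {0..t} - {}" for s
        using dev[of s x] that mult_left_mono[of s t c] c0 by auto
    qed (use c0 t in auto)
    then have "\<bar>semigroup_op p t (iter k) x - iter k x - t * iter (Suc k) x\<bar> / t \<le> (c * t) * t / t"
      using t by (intro divide_right_mono) auto
    also have "\<bar>semigroup_op p t (iter k) x - iter k x - t * iter (Suc k) x\<bar> / t =
        \<bar>(semigroup_op p t (iter k) x - iter k x - t * iter (Suc k) x) / t\<bar>"
      using t by simp
    also have "(semigroup_op p t (iter k) x - iter k x - t * iter (Suc k) x) / t = (semigroup_op p t (iter k) x - iter k x) / t - iter (Suc k) x"
      using t by (simp add: diff_divide_distrib)
    finally show ?thesis using t by simp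
  qed
  have "uniform_limit UNIV (\<lambda>t x. (semigroup_op p t (iter k) x - iter k x) / t) (iter (Suc k)) (at_right 0)"
  proof (rule uniform_limitI)
    fix e :: real assume e: "0 < e"
    have "\<forall>\<^sub>F t in at_right 0. t < e / (c + 1)"
      using e c0 by (intro order_tendstoD(2)[OF tendsto_ident_at]) auto
    moreover have "\<forall>\<^sub>F t in at_right (0::real). 0 < t"
      by (simp add: eventually_at_right_less)
    ultimately show "\<forall>\<^sub>F t in at_right 0. \<forall>x\<in>UNIV. dist ((semigroup_op p t (iter k) x - iter k x) / t) (iter (Suc k) x) < e"
    proof eventually_elim
      case (elim t)
      have "c * t \<le> (c + 1) * t" using elim by simp
      also have "\<dots> < e" using elim c0 by (simp add: field_simps)
      finally have "c * t < e" .
      then show ?case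
        using le_less_trans[OF quot[OF elim(2)]] by (simp add: dist_real_def)
    qed
  qed
  then show ?thesis
    using iterate_C0 unfolding is_generator_value_def by blast
qed

lemma generator_iterate: "(generator p ^^ k) g = iter k"
proof (induction k)
  case (Suc k)
  have "generator p (iter k) = iter (Suc k)"
    by (rule generator_eqI[OF is_generator_value_iterate])
  then show ?case using Suc by simp
qed simp

lemma generator_iterate_in_domain: "(generator p ^^ k) g \<in> generator_domain p"
  using is_generator_value_iterate generator_iterate unfolding generator_domain_def by auto

text \<open>Induction on the number of terms: Dynkin's formula expresses the remainder for the \<open>k\<close>-th iterate
as the time integral of the remainder, one term shorter, for the next iterate.\<close>

lemma taylor_remainder:
  assumes M: "\<And>y. \<bar>iter (k + n) y\<bar> \<le> M" and t: "0 \<le> t"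
  shows "\<bar>semigroup_op p t (iter k) x - (\<Sum>j<n. t ^ j / fact j * iter (k + j) x)\<bar> \<le> t ^ n / fact n * M"
  using M t
proof (induction n arbitrary: k t)
  case 0
  then show ?case using semigroup_op_bound[OF _ iterate_measurable] by simp
next
  case (Suc n)
  let ?u = "\<lambda>s. semigroup_op p s (iter (Suc k)) x"
  let ?q = "\<lambda>s. \<Sum>j<n. s ^ j / fact j * iter (Suc k + j) x"
  have q: "(?q has_integral (\<Sum>j<n. t ^ Suc j / fact (Suc j) * iter (Suc k + j) x)) {0..t}"
    by (intro has_integral_sum has_integral_mult_left has_integral_power_over_fact Suc.prems) auto
  have d: "((\<lambda>s. ?u s - ?q s) has_integral
      (semigroup_op p t (iter k) x - iter k x - (\<Sum>j<n. t ^ Suc j / fact (Suc j) * iter (Suc k + j) x))) {0..t}"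
    by (rule has_integral_diff[OF iterate_integral[OF Suc.prems(2)] q])
  have r: "((\<lambda>s. s ^ n / fact n * M) has_integral (t ^ Suc n / fact (Suc n) * M)) {0..t}"
    by (intro has_integral_mult_left has_integral_power_over_fact Suc.prems)
  have "norm (integral {0..t} (\<lambda>s. ?u s - ?q s)) \<le> integral {0..t} (\<lambda>s. s ^ n / fact n * M)"
  proof (rule integral_norm_bound_integral)
    show "norm (?u s - ?q s) \<le> s ^ n / fact n * M" if "s \<in> {0..t}" for s
      using Suc.IH[of "Suc k" s] Suc.prems(1) that by simp
  qed (use d r in \<open>auto simp: has_integral_iff\<close>)
  then have "\<bar>semigroup_op p t (iter k) x - iter k x - (\<Sum>j<n. t ^ Suc j / fact (Suc j) * iter (Suc k + j) x)\<bar> \<le>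
      t ^ Suc n / fact (Suc n) * M"
    using d r by (simp only: has_integral_iff real_norm_def)
  moreover have "(\<Sum>j<Suc n. t ^ j / fact j * iter (k + j) x) =
      iter k x + (\<Sum>j<n. t ^ Suc j / fact (Suc j) * iter (Suc k + j) x)"
    by (subst sum.lessThan_Suc_shift) (simp del: fact_Suc funpow.simps)
  ultimately show ?case
    by (simp only: diff_diff_eq)
qed

text \<open>The number of terms and the step \<open>1 / n\<close> of the Hoelder exponents are tied together: the remainder
is at most \<open>K * (2 * D * t)\<^sup>n * n\<^sup>n / n!\<close>, a geometric sequence with ratio \<open>2 * D * t * exp 1\<close>.\<close>

lemma semigroup_taylor_sums:
  assumes t: "0 < t" "t < 1 / (2 * D * exp 1)"
  shows "(\<lambda>j. t ^ j / fact j * iter j x) sums semigroup_op p t g x"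
  unfolding sums_def
proof (rule LIM_zero_cancel, rule Lim_null_comparison)
  define \<rho> where "\<rho> = 2 * D * t * exp 1"
  have \<rho>: "0 \<le> \<rho>" "\<rho> < 1"
    using t D_pos by (auto simp: \<rho>_def field_simps)
  have "norm ((\<Sum>j<n. t ^ j / fact j * iter j x) - semigroup_op p t g x) \<le> \<rho> ^ n * K" if n: "0 < n" for n
  proof -
    have "norm ((\<Sum>j<n. t ^ j / fact j * iter j x) - semigroup_op p t g x) =
        \<bar>semigroup_op p t (iter 0) x - (\<Sum>j<n. t ^ j / fact j * iter (0 + j) x)\<bar>"
      by (simp add: abs_minus_commute)
    also have "\<dots> \<le> t ^ n / fact n * ((2 * D * real n) ^ n * K)"
      using t by (intro taylor_remainder) (auto intro!: iterate_bound n)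
    also have "\<dots> = (2 * D * t) ^ n * K * (real n ^ n / fact n)"
      by (simp add: power_mult_distrib)
    also have "\<dots> \<le> (2 * D * t) ^ n * K * exp (real n)"
      using nat_power_le_fact_exp[of n] K D_pos t
      by (intro mult_left_mono) (auto simp: field_simps)
    also have "\<dots> = \<rho> ^ n * K"
      by (simp add: \<rho>_def power_mult_distrib exp_of_nat_mult[symmetric])
    finally show ?thesis .
  qed
  then show "\<forall>\<^sub>F n in sequentially. norm ((\<Sum>j<n. t ^ j / fact j * iter j x) - semigroup_op p t g x) \<le> \<rho> ^ n * K"
    using eventually_gt_at_top[of 0] by (rule eventually_mono[rotated])
  show "(\<lambda>n. \<rho> ^ n * K) \<longlonglongrightarrow> 0"
    using \<rho> by (intro tendsto_mult_left_zero LIMSEQ_power_zero) auto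
qed

end

end

section \<open>Heat content and nonlocal perimeter\<close>

lemma image_minus_Compl: "(\<lambda>z. z - x) ` (- \<Omega>) = {y. x + y \<notin> (\<Omega> :: 'a::ab_group_add set)}"
  by (force simp: image_iff algebra_simps)

context levy_semigroup
begin

text \<open>Exchange the integrals: for a fixed shift \<open>y\<close> the points of \<open>\<Omega>\<close> that leave \<open>\<Omega>\<close> have measure \<open>g 0 - g y\<close>.\<close>

lemma heat_loss_eq:
  assumes \<Omega> [measurable]: "\<Omega> \<in> sets borel" and fin: "emeasure lborel \<Omega> < \<infinity>" and t: "0 \<le> t"
    and cov: "continuous_on UNIV (covariance_fun \<Omega>)"
  shows "heat_loss p \<Omega> t = covariance_fun \<Omega> 0 - semigroup_op p t (covariance_fun \<Omega>) 0"
proof -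
  interpret pt: prob_space "p t" using t by (rule prob_p)
  note [measurable_cong] = sets_p[OF t]
  have [simp]: "space (p t) = UNIV"
    using sets_eq_imp_space_eq[OF sets_p[OF t]] by simp
  have [measurable]: "covariance_fun \<Omega> \<in> borel_measurable borel"
    using cov by (rule borel_measurable_continuous_onI)
  define I where "I x y = indicat_real \<Omega> x * indicator (- \<Omega>) (x + y)" for x y
  have "heat_loss p \<Omega> t = (LINT x|lborel. LINT y|p t. I x y)"
    unfolding heat_loss_def set_lebesgue_integral_def
  proof (rule Bochner_Integration.integral_cong[OF refl])
    fix x
    have "(LINT y|p t. I x y) = indicat_real \<Omega> x * (LINT y|p t. indicator {y. x + y \<notin> \<Omega>} y)"
      by (simp add: I_def indicator_def integral_mult_right_zero)
    also have "(LINT y|p t. indicat_real {y. x + y \<notin> \<Omega>} y) = measure (p t) {y. x + y \<notin> \<Omega>}"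
      by simp
    finally show "indicat_real \<Omega> x *\<^sub>R measure (p t) ((\<lambda>z. z - x) ` (- \<Omega>)) = (LINT y|p t. I x y)"
      by (simp add: image_minus_Compl)
  qed
  also have "\<dots> = (LINT y|p t. LINT x|lborel. I x y)"
  proof (rule fubini_swap_dominated(1)[symmetric, where a = "indicator \<Omega>" and b = "\<lambda>_. 1"])
    show "sigma_finite_measure (p t)" by unfold_locales
    show "(\<lambda>(x, y). I x y) \<in> borel_measurable (lborel \<Otimes>\<^sub>M p t)"
      unfolding I_def by measurable
    show "integrable lborel (indicat_real \<Omega>)"
      using fin by (intro integrable_real_indicator) auto
  qed (auto simp: I_def indicator_def sigma_finite_lborel)
  also have "\<dots> = (LINT y|p t. covariance_fun \<Omega> 0 - covariance_fun \<Omega> y)"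
  proof (rule Bochner_Integration.integral_cong[OF refl])
    fix y
    have "(LINT x|lborel. I x y) = (LINT x|lborel. indicat_real {x \<in> \<Omega>. x + y \<notin> \<Omega>} x)"
      by (rule Bochner_Integration.integral_cong) (auto simp: I_def indicator_def)
    then show "(LINT x|lborel. I x y) = covariance_fun \<Omega> 0 - covariance_fun \<Omega> y"
      by (simp add: covariance_fun_deficit_eq[OF \<Omega> fin])
  qed
  also have "\<dots> = covariance_fun \<Omega> 0 - semigroup_op p t (covariance_fun \<Omega>) 0"
  proof -
    have "integrable (p t) (covariance_fun \<Omega>)"
      by (rule pt.integrable_const_bound[of _ "covariance_fun \<Omega> 0"])
        (use covariance_fun_le_0[OF \<Omega> fin] covariance_fun_nonneg[OF \<Omega> fin] in auto)
    then show ?thesis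
      using pt.prob_space by (simp add: semigroup_op_def)
  qed
  finally show ?thesis .
qed

text \<open>The same exchange as for the heat loss, with \<open>\<nu>\<close> in place of \<open>p t\<close>.\<close>

lemma nonlocal_perimeter_eq:
  assumes \<Omega> [measurable]: "\<Omega> \<in> sets borel" and fin: "emeasure lborel \<Omega> < \<infinity>"
    and int: "integrable \<nu> (\<lambda>y. covariance_fun \<Omega> (0 + y) - covariance_fun \<Omega> 0)"
  shows "nonlocal_perimeter \<nu> \<Omega> = ennreal (- jump_op \<nu> (covariance_fun \<Omega>) 0)"
proof -
  interpret pair_sigma_finite lborel \<nu>
    using sigma_finite_lborel sigma_finite_nu by (rule pair_sigma_finite.intro)
  define I where "I x y = (indicator \<Omega> x * indicator (- \<Omega>) (x + y) :: ennreal)" for x y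
  have Im: "(\<lambda>(x, y). I x y) \<in> borel_measurable (lborel \<Otimes>\<^sub>M \<nu>)"
    unfolding I_def by measurable
  have "nonlocal_perimeter \<nu> \<Omega> = (\<integral>\<^sup>+x. \<integral>\<^sup>+y. I x y \<partial>\<nu> \<partial>lborel)"
    unfolding nonlocal_perimeter_def
  proof (rule nn_integral_cong)
    fix x
    have "(\<integral>\<^sup>+y. I x y \<partial>\<nu>) = (\<integral>\<^sup>+y. indicator \<Omega> x * indicator {y. x + y \<notin> \<Omega>} y \<partial>\<nu>)"
      by (rule nn_integral_cong) (auto simp: I_def indicator_def)
    also have "\<dots> = indicator \<Omega> x * emeasure \<nu> {y. x + y \<notin> \<Omega>}"
      by (rule nn_integral_cmult_indicator) measurable
    finally show "emeasure \<nu> ((\<lambda>z. z - x) ` (- \<Omega>)) * indicator \<Omega> x = (\<integral>\<^sup>+y. I x y \<partial>\<nu>)"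
      by (simp add: image_minus_Compl mult.commute)
  qed
  also have "\<dots> = (\<integral>\<^sup>+y. \<integral>\<^sup>+x. I x y \<partial>lborel \<partial>\<nu>)"
    by (rule Fubini'[OF Im, symmetric])
  also have "\<dots> = (\<integral>\<^sup>+y. ennreal (covariance_fun \<Omega> 0 - covariance_fun \<Omega> (0 + y)) \<partial>\<nu>)"
  proof (rule nn_integral_cong)
    fix y
    have fm: "{x \<in> \<Omega>. x + y \<notin> \<Omega>} \<in> fmeasurable lborel"
      by (rule fmeasurableI2[OF fmeasurable_self[OF \<Omega> fin]]) auto
    have "(\<integral>\<^sup>+x. I x y \<partial>lborel) = (\<integral>\<^sup>+x. indicator {x \<in> \<Omega>. x + y \<notin> \<Omega>} x \<partial>lborel)"
      by (rule nn_integral_cong) (auto simp: I_def indicator_def)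
    also have "\<dots> = ennreal (measure lborel {x \<in> \<Omega>. x + y \<notin> \<Omega>})"
      using fm by (simp add: emeasure_eq_measure2 fmeasurableD)
    finally show "(\<integral>\<^sup>+x. I x y \<partial>lborel) = ennreal (covariance_fun \<Omega> 0 - covariance_fun \<Omega> (0 + y))"
      by (simp add: covariance_fun_deficit_eq[OF \<Omega> fin])
  qed
  also have "\<dots> = ennreal (LINT y|\<nu>. covariance_fun \<Omega> 0 - covariance_fun \<Omega> (0 + y))"
  proof (rule nn_integral_eq_integral)
    show "integrable \<nu> (\<lambda>y. covariance_fun \<Omega> 0 - covariance_fun \<Omega> (0 + y))"
      using Bochner_Integration.integrable_minus[OF int] by simp
  qed (use covariance_fun_le_0[OF \<Omega> fin] in auto)
  also have "(LINT y|\<nu>. covariance_fun \<Omega> 0 - covariance_fun \<Omega> (0 + y)) = - jump_op \<nu> (covariance_fun \<Omega>) 0"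
    unfolding jump_op_def by (subst Bochner_Integration.integral_minus[symmetric]) simp
  finally show ?thesis .
qed

end

theorem corollary3:
  fixes \<nu> :: "(real^'d) measure"
    and p :: "real \<Rightarrow> (real^'d) measure"
    and \<Omega> :: "(real^'d) set"
  assumes nu_borel: "sets \<nu> = sets borel"
    and nu_zero: "emeasure \<nu> {0} = 0"
    and nu_int: "(\<integral>\<^sup>+z. ennreal (min 1 (norm z)) \<partial>\<nu>) < \<infinity>"
    and p_semigroup: "convolution_semigroup p"
    and p_fourier: "\<And>t \<xi>. 0 \<le> t \<Longrightarrow>
          (LINT x|p t. iexp (\<xi> \<bullet> x)) = exp (- (complex_of_real t * levy_exponent \<nu> \<xi>))"
    and Omega: "open \<Omega>" "\<Omega> \<noteq> {}" "emeasure lborel \<Omega> < \<infinity>" "perimeter \<Omega> < \<infinity>"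
    and h_scaling: "\<exists>C>0. \<forall>\<alpha> l r. 0 < \<alpha> \<and> \<alpha> < 1 \<and> 0 < l \<and> l \<le> 1 \<and> 0 < r \<and> r < 1 \<longrightarrow>
          conc_fun \<nu> (l * r) \<le> C * inverse \<alpha> * l powr (- \<alpha>) * conc_fun \<nu> r"
  shows "nonlocal_perimeter \<nu> \<Omega> < \<infinity> \<and>
    (\<forall>k. (generator p ^^ k) (covariance_fun \<Omega>) \<in> generator_domain p) \<and>
    (\<exists>t0>0. \<forall>t. 0 < t \<and> t < t0 \<longrightarrow>
       summable (\<lambda>k. t ^ (k + 2) / fact (k + 2) * (generator p ^^ (k + 2)) (covariance_fun \<Omega>) 0) \<and>
       heat_loss p \<Omega> t = t * enn2real (nonlocal_perimeter \<nu> \<Omega>) -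
         (\<Sum>k. t ^ (k + 2) / fact (k + 2) * (generator p ^^ (k + 2)) (covariance_fun \<Omega>) 0))"
proof -
  interpret levy_measure \<nu>
    using nu_borel nu_zero nu_int by (rule levy_measure.intro)
  interpret levy_semigroup \<nu> p
  proof (intro levy_semigroup.intro levy_semigroup_axioms.intro levy_measure_axioms)
    show "prob_space (p t)" "sets (p t) = sets borel" if "0 \<le> t" for t
      using p_semigroup that by (simp_all add: convolution_semigroup_def)
  qed (rule p_fourier)
  obtain D where D: "0 < D" "\<And>\<beta>. 0 < \<beta> \<Longrightarrow> \<beta> \<le> 1 \<Longrightarrow>
      integrable \<nu> (\<lambda>z. tnorm z powr \<beta>) \<and> (LINT z|\<nu>. tnorm z powr \<beta>) \<le> D / \<beta>"
    by (rule tnorm_powr_moments_from_scaling[OF h_scaling]) blast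
  interpret log_levy_semigroup \<nu> p D
    by unfold_locales (simp_all add: D)
  let ?g = "covariance_fun \<Omega>"
  have borel: "\<Omega> \<in> sets borel"
    using Omega(1) by simp
  note fin = Omega(3)
  obtain P where P: "0 \<le> P" "perimeter \<Omega> \<le> ereal P"
  proof (cases "perimeter \<Omega>")
    case (real r)
    then show ?thesis by (intro that[of "max r 0"]) auto
  next
    case PInf
    then show ?thesis using Omega(4) by simp
  next
    case MInf
    then show ?thesis by (intro that[of 0]) auto
  qed
  \<comment> \<open>The perimeter bounds small shifts and the total mass \<open>g 0\<close> bounds large ones.\<close>
  define K where "K = max P (?g 0)"
  have K: "0 \<le> K" using P by (simp add: K_def)
  have g_holder: "holder 1 K ?g"
    unfolding holder_def
  proof (intro allI)
    fix x y :: "real^'d"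
    let ?z = "x - y"
    have "?g 0 - ?g ?z \<le> K * norm ?z"
      using covariance_fun_shift_le[OF borel fin Omega(1,2) P(2), of ?z]
        mult_right_mono[of P K "norm ?z"] by (simp add: K_def)
    moreover have "?g 0 - ?g ?z \<le> K * 1"
      using covariance_fun_nonneg[OF borel fin, of ?z] by (simp add: K_def)
    ultimately have "?g 0 - ?g ?z \<le> K * tnorm ?z"
      by (simp add: tnorm_def min_def)
    then show "\<bar>?g x - ?g y\<bar> \<le> K * tnorm ?z powr 1"
      using covariance_fun_diff_le[OF borel fin, of x y] by simp
  qed
  have cont: "continuous_on UNIV ?g"
    by (rule holder_continuous[OF g_holder]) simp
  have C0: "?g \<in> C0"
    using cont covariance_fun_tendsto_0[OF borel fin] by (simp add: C0_def)
  note gen = generator_iterate[OF g_holder K C0]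
  have per: "nonlocal_perimeter \<nu> \<Omega> = ennreal (- jump_op \<nu> ?g 0)"
    by (intro nonlocal_perimeter_eq[OF borel fin] integrable_increment[OF g_holder] integrable_moment) auto
  have jump_nonpos: "jump_op \<nu> ?g 0 \<le> 0"
  proof -
    have "0 \<le> (LINT y|\<nu>. - (?g (0 + y) - ?g 0))"
      by (rule Bochner_Integration.integral_nonneg) (simp add: covariance_fun_le_0[OF borel fin])
    then show ?thesis
      unfolding jump_op_def Bochner_Integration.integral_minus by simp
  qed
  show ?thesis
  proof (intro conjI exI[of _ "1 / (2 * D * exp 1)"] allI impI)
    show "nonlocal_perimeter \<nu> \<Omega> < \<infinity>"
      by (simp add: per)
    show "(generator p ^^ k) ?g \<in> generator_domain p" for k
      by (rule generator_iterate_in_domain[OF g_holder K C0])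
    show "0 < 1 / (2 * D * exp 1)"
      using D by simp
    fix t assume t: "0 < t \<and> t < 1 / (2 * D * exp 1)"
    let ?a = "\<lambda>k. t ^ k / fact k * (generator p ^^ k) ?g 0"
    have "?a sums semigroup_op p t ?g 0"
      unfolding gen using t by (intro semigroup_taylor_sums[OF g_holder K C0]) auto
    then have "?a sums ((semigroup_op p t ?g 0 - (\<Sum>k<2. ?a k)) + (\<Sum>k<2. ?a k))"
      by simp
    then have s: "(\<lambda>k. ?a (k + 2)) sums (semigroup_op p t ?g 0 - (\<Sum>k<2. ?a k))"
      by (simp only: sums_iff_shift[of ?a 2])
    then show "summable (\<lambda>k. ?a (k + 2))"
      by (rule sums_summable)
    have "heat_loss p \<Omega> t = ?g 0 - semigroup_op p t ?g 0"
      using t by (intro heat_loss_eq[OF borel fin _ cont]) auto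
    moreover have "(\<Sum>k<2. ?a k) = ?g 0 + t * jump_op \<nu> ?g 0"
      unfolding gen by (simp add: eval_nat_numeral)
    moreover have "enn2real (nonlocal_perimeter \<nu> \<Omega>) = - jump_op \<nu> ?g 0"
      using jump_nonpos by (simp add: per)
    ultimately show "heat_loss p \<Omega> t = t * enn2real (nonlocal_perimeter \<nu> \<Omega>) - (\<Sum>k. ?a (k + 2))"
      using sums_unique[OF s] by simp
  qed
qed

end
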